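(* Let $\beta>0$, let $\nu$ be a compactly supported probability measure on $\mathbb{R}$, and let $\mu$ be either the semicircle law on $[-2\beta,2\beta]$ or the Marchenko-Pastur law with parameter $\beta$. For $h\in(-\infty,\operatorname{supp}_-\nu)$ let $$F_{\mu,\nu}(h)=h-\beta^2G_\nu(h)\ \text{ (semicircle case)},\qquad F_{\mu,\nu}(h)=h+\frac{\beta}{1+G_\nu(h)}\ \text{ (Marchenko-Pastur case)}.$$ Then $$z^*_{\mu\boxplus\nu}=\sup_{h\in(-\infty,\operatorname{supp}_-\nu)}F_{\mu,\nu}(h)\qquad\text{and}\qquad g^*_{\mu\boxplus\nu}=G_\nu\left(\underset{h\in(-\infty,\operatorname{supp}_-\nu)}{\operatorname{argsup}}F_{\mu,\nu}(h)\right).$$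
   Context: The semicircle law on $[-2\beta,2\beta]$ is $\frac{1}{2\pi\beta^2}\sqrt{4\beta^2-\lambda^2}\,1_{[-2\beta,2\beta]}(\lambda)d\lambda$. The Marchenko-Pastur law with parameter $\beta$ is $\max(1-\beta,0)\delta_0+\frac{\sqrt{(\lambda_+-\lambda)(\lambda-\lambda_-)}}{2\pi\lambda}1_{[\lambda_-,\lambda_+]}(\lambda)d\lambda$, $\lambda_\pm=(1\pm\sqrt\beta)^2$. $\mu\boxplus\nu$ is the free additive convolution. For a compactly supported probability measure $\rho$ on $\mathbb{R}$, $\operatorname{supp}_-\rho$ is the infimum of its support and $G_\rho(z)=\int\frac{\rho(d\lambda)}{\lambda-z}$ (note the sign). $z^*_{\mu\boxplus\nu}=\operatorname{supp}_-(\mu\boxplus\nu)$ and $g^*_{\mu\boxplus\nu}=\lim_{z\uparrow z^*_{\mu\boxplus\nu}}G_{\mu\boxplus\nu}(z)\in(0,\infty]$. Convention: $\operatorname{argsup}$ is the point of $(-\infty,\operatorname{supp}_-\nu)$ at which the supremum is attained; if it is not attained there, it is the endpoint $\operatorname{supp}_-\nu$ at which the supremum is approached as a limit, and $G_\nu(\operatorname{supp}_-\nu)$ denotes $\lim_{h\uparrow\operatorname{supp}_-\nu}G_\nu(h)\in(0,\infty]$. *)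

theory Defs
  imports
    "HOL-Probability.Probability"
    "HOL-Library.Poly_Mapping"
    "HOL-Computational_Algebra.Polynomial"
begin

section \<open>Supports and Stieltjes transforms\<close>

definition measure_support :: "real measure \<Rightarrow> real set" where
  "measure_support M = {x. \<forall>U. open U \<longrightarrow> x \<in> U \<longrightarrow> emeasure M U > 0}"

definition compactly_supported_distribution :: "real measure \<Rightarrow> bool" where
  "compactly_supported_distribution M \<longleftrightarrow> real_distribution M \<and> compact (measure_support M)"

definition supp_inf :: "real measure \<Rightarrow> real" where
  "supp_inf M = Inf (measure_support M)"

text \<open>Sign convention: the integrand is \<open>1 / (x - z)\<close>, so the transform is positive to the left
  of the support. Only real arguments below the support occur.\<close>

definition stieltjes :: "real measure \<Rightarrow> real \<Rightarrow> real" where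
  "stieltjes M z = (\<integral>x. 1 / (x - z) \<partial>M)"

text \<open>The limit at the left edge of the support may be \<open>\<infinity>\<close>.\<close>

definition stieltjes_edge :: "real measure \<Rightarrow> ereal" where
  "stieltjes_edge M = Lim (at_left (supp_inf M)) (\<lambda>z. ereal (stieltjes M z))"

definition stieltjes_ext :: "real measure \<Rightarrow> real \<Rightarrow> ereal" where
  "stieltjes_ext M h = (if h < supp_inf M then ereal (stieltjes M h) else stieltjes_edge M)"

section \<open>The semicircle and Marchenko-Pastur laws\<close>

definition semicircle_law :: "real \<Rightarrow> real measure" where
  "semicircle_law \<beta> = density lborel (\<lambda>x. ennreal
     (1 / (2 * pi * \<beta>\<^sup>2) * sqrt (4 * \<beta>\<^sup>2 - x\<^sup>2) * indicator {- 2 * \<beta> .. 2 * \<beta>} x))"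

definition mp_lower :: "real \<Rightarrow> real" where
  "mp_lower \<beta> = (1 - sqrt \<beta>)\<^sup>2"

definition mp_upper :: "real \<Rightarrow> real" where
  "mp_upper \<beta> = (1 + sqrt \<beta>)\<^sup>2"

definition mp_density :: "real \<Rightarrow> real \<Rightarrow> real" where
  "mp_density \<beta> x = sqrt ((mp_upper \<beta> - x) * (x - mp_lower \<beta>)) / (2 * pi * x)
     * indicator {mp_lower \<beta> .. mp_upper \<beta>} x"

definition marchenko_pastur_law :: "real \<Rightarrow> real measure" where
  "marchenko_pastur_law \<beta> = measure_of UNIV (sets borel)
     (\<lambda>A. ennreal (max (1 - \<beta>) 0) * emeasure (return borel 0) A
          + emeasure (density lborel (\<lambda>x. ennreal (mp_density \<beta> x))) A)"

lemma sets_marchenko_pastur_law [simp]: "sets (marchenko_pastur_law \<beta>) = sets borel"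
  unfolding marchenko_pastur_law_def using sets.sigma_sets_eq[of borel]
  by (simp add: sets_measure_of_conv)

lemma emeasure_marchenko_pastur_law:
  assumes "A \<in> sets borel"
  shows "emeasure (marchenko_pastur_law \<beta>) A
    = ennreal (max (1 - \<beta>) 0) * emeasure (return borel 0) A
      + emeasure (density lborel (\<lambda>x. ennreal (mp_density \<beta> x))) A"
  unfolding marchenko_pastur_law_def
proof (rule emeasure_measure_of_sigma[OF _ _ _ assms])
  show "sigma_algebra UNIV (sets (borel :: real measure))"
    by (metis sets.sigma_algebra_axioms space_borel)
  show "countably_additive (sets borel)
     (\<lambda>A :: real set. ennreal (max (1 - \<beta>) 0) * emeasure (return borel 0) A
          + emeasure (density lborel (\<lambda>x. ennreal (mp_density \<beta> x))) A)"
  proof (rule countably_additiveI)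
    fix A :: "nat \<Rightarrow> real set"
    assume A: "range A \<subseteq> sets borel" "disjoint_family A"
    have "suminf (\<lambda>i. emeasure (return borel 0) (A i)) = emeasure (return borel 0) (\<Union>i. A i)"
      using A by (intro suminf_emeasure) auto
    moreover have "suminf (\<lambda>i. emeasure (density lborel (\<lambda>x. ennreal (mp_density \<beta> x))) (A i))
      = emeasure (density lborel (\<lambda>x. ennreal (mp_density \<beta> x))) (\<Union>i. A i)"
      using A by (intro suminf_emeasure) auto
    ultimately show "suminf (\<lambda>i. ennreal (max (1 - \<beta>) 0) * emeasure (return borel 0) (A i)
          + emeasure (density lborel (\<lambda>x. ennreal (mp_density \<beta> x))) (A i))
      = ennreal (max (1 - \<beta>) 0) * emeasure (return borel 0) (\<Union>i. A i)
          + emeasure (density lborel (\<lambda>x. ennreal (mp_density \<beta> x))) (\<Union>i. A i)"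
      by (simp flip: suminf_add)
  qed
qed (simp add: positive_def)

section \<open>Free additive convolution\<close>

text \<open>The algebra of noncommutative polynomials over the complex numbers in two variables,
  as the monoid algebra of the free monoid on two letters.\<close>

datatype nc_var = VarX | VarY

datatype nc_word = NC_Word (letters: "nc_var list")

instantiation nc_word :: monoid_add
begin

definition zero_nc_word :: nc_word where
  "0 = NC_Word []"

definition plus_nc_word :: "nc_word \<Rightarrow> nc_word \<Rightarrow> nc_word" where
  "v + w = NC_Word (letters v @ letters w)"

instance
  by standard (simp_all add: zero_nc_word_def plus_nc_word_def)

end

type_synonym nc_poly = "nc_word \<Rightarrow>\<^sub>0 complex"

definition nc_var :: "nc_var \<Rightarrow> nc_poly" where
  "nc_var i = Poly_Mapping.single (NC_Word [i]) 1"

definition nc_const :: "complex \<Rightarrow> nc_poly" where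
  "nc_const c = Poly_Mapping.single 0 c"

definition nc_eval :: "complex poly \<Rightarrow> nc_poly \<Rightarrow> nc_poly" where
  "nc_eval p a = (\<Sum>k\<le>degree p. nc_const (coeff p k) * a ^ k)"

text \<open>The joint distribution of a pair \<open>(a, b)\<close> in a noncommutative probability space \<open>(A, \<tau>)\<close> is
  the functional \<open>P(X, Y) \<mapsto> \<tau> (P(a, b))\<close>. Conversely a unital linear functional makes the
  noncommutative polynomials a noncommutative probability space, so it suffices to consider
  the variables \<open>X\<close> and \<open>Y\<close> themselves.\<close>

definition unital_functional :: "(nc_poly \<Rightarrow> complex) \<Rightarrow> bool" where
  "unital_functional \<phi> \<longleftrightarrow>
     \<phi> 1 = 1 \<and> (\<forall>p q. \<phi> (p + q) = \<phi> p + \<phi> q) \<and> (\<forall>c p. \<phi> (nc_const c * p) = c * \<phi> p)"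

text \<open>Freeness of the unital subalgebras generated by \<open>X\<close> and by \<open>Y\<close>: alternating products
  of centred elements are centred.\<close>

definition free_variables :: "(nc_poly \<Rightarrow> complex) \<Rightarrow> bool" where
  "free_variables \<phi> \<longleftrightarrow>
     (\<forall>ps :: (nc_var \<times> complex poly) list.
        ps \<noteq> [] \<longrightarrow> distinct_adj (map fst ps) \<longrightarrow>
        (\<forall>(i, p) \<in> set ps. \<phi> (nc_eval p (nc_var i)) = 0) \<longrightarrow>
        \<phi> (prod_list (map (\<lambda>(i, p). nc_eval p (nc_var i)) ps)) = 0)"

definition has_law :: "(nc_poly \<Rightarrow> complex) \<Rightarrow> nc_poly \<Rightarrow> real measure \<Rightarrow> bool" where
  "has_law \<phi> a M \<longleftrightarrow> (\<forall>k. \<phi> (a ^ k) = complex_of_real (\<integral>x. x ^ k \<partial>M))"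

text \<open>\<open>\<rho>\<close> is the law of the sum of two free variables with laws \<open>\<mu>\<close> and \<open>\<nu>\<close>, which are meant to be
  compactly supported distributions: all these laws are then determined by their moments,
  so that \<open>\<rho>\<close> is unique.\<close>

definition is_free_convolution :: "real measure \<Rightarrow> real measure \<Rightarrow> real measure \<Rightarrow> bool" where
  "is_free_convolution \<mu> \<nu> \<rho> \<longleftrightarrow>
     compactly_supported_distribution \<rho> \<and>
     (\<exists>\<phi>. unital_functional \<phi> \<and> free_variables \<phi> \<and>
          has_law \<phi> (nc_var VarX) \<mu> \<and> has_law \<phi> (nc_var VarY) \<nu> \<and>
          has_law \<phi> (nc_var VarX + nc_var VarY) \<rho>)"

section \<open>The point where a supremum is attained or approached\<close>

definition is_argsup_below :: "real \<Rightarrow> (real \<Rightarrow> real) \<Rightarrow> real \<Rightarrow> bool" where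
  "is_argsup_below e F h \<longleftrightarrow>
     is_arg_max F (\<lambda>x. x < e) h \<or>
     (\<nexists>x. is_arg_max F (\<lambda>x. x < e) x) \<and> h = e \<and>
       ((\<lambda>x. ereal (F x)) \<longlongrightarrow> (SUP x\<in>{..<e}. ereal (F x))) (at_left e)"

definition argsup_below :: "real \<Rightarrow> (real \<Rightarrow> real) \<Rightarrow> real" where
  "argsup_below e F = (THE h. is_argsup_below e F h)"

end

theory Submission
  imports Defs "HOL-Complex_Analysis.Complex_Analysis"
begin

text \<open>Write \<open>G\<close> for the Stieltjes transform. In a ring of formal power series over the noncommutative
  polynomials, freeness yields the functional equation relating the Cauchy transforms of \<open>X\<close>, \<open>Y\<close>
  and \<open>X + Y\<close>. The two laws have R-transforms \<open>\<beta>\<^sup>2 g\<close> and \<open>\<beta> / (1 - g)\<close>, so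
  \<open>G\<^sub>\<rho> (F h) = G\<^sub>\<nu> h\<close> for \<open>h\<close> near \<open>-\<infinity>\<close>, where \<open>F h = h + \<kappa> (G\<^sub>\<nu> h)\<close> with
  \<open>\<kappa> g = - \<beta>\<^sup>2 g\<close> or \<open>\<kappa> g = \<beta> / (1 + g)\<close> (the sign of \<open>G\<close> is opposite to that of the Cauchy transform). The map
  \<open>H z = z - \<kappa> (G\<^sub>\<rho> z)\<close> is increasing and inverts \<open>F\<close> near \<open>-\<infinity>\<close>. The edge of the support is a
  singularity of the Stieltjes transform. Hence \<open>H z\<close> cannot reach the edge of \<open>\<nu>\<close> while \<open>z\<close> is below
  the edge of \<open>\<rho>\<close>, and \<open>F\<close> inverts \<open>H\<close> all the way. If \<open>H\<close> ends at a point \<open>h\<close> below the edge of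
  \<open>\<nu>\<close>, then \<open>F' h = 0\<close>, since otherwise \<open>F\<close> would continue \<open>G\<^sub>\<rho>\<close> past its edge, and \<open>h\<close> is the strict
  maximum of \<open>F\<close> by concavity. If \<open>H\<close> ends at the edge of \<open>\<nu>\<close>, then \<open>F\<close> is increasing on the whole
  ray and its supremum is approached at that edge.\<close>

unbundle fps_syntax and no vec_syntax

section \<open>The functional equation of free convolution\<close>

text \<open>The series variable \<open>t\<close> is central. Scalar series will be a central
  subring, while a fixed polynomial \<open>a\<close> enters as \<open>fps_const a\<close>.\<close>

definition fps_scalar :: "complex fps \<Rightarrow> nc_poly fps" where
  "fps_scalar f = Abs_fps (\<lambda>n. nc_const (f $ n))"

definition fps_functional :: "(nc_poly \<Rightarrow> complex) \<Rightarrow> nc_poly fps \<Rightarrow> complex fps" where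
  "fps_functional \<phi> P = Abs_fps (\<lambda>n. \<phi> (P $ n))"

definition moment_fps :: "real measure \<Rightarrow> complex fps" where
  "moment_fps M = Abs_fps (\<lambda>n. complex_of_real (\<integral>x. x ^ n \<partial>M))"

text \<open>\<open>\<Sum>\<^sub>k v\<^sup>k a\<^sup>k = (1 - v a)\<^sup>-\<^sup>1\<close> for \<open>v\<close> without constant term, when \<open>v\<^sup>k\<close> with \<open>k > n\<close> does not
  contribute to the \<open>n\<close>-th coefficient.\<close>

definition fps_resolvent :: "complex fps \<Rightarrow> nc_poly \<Rightarrow> nc_poly fps" where
  "fps_resolvent v a = Abs_fps (\<lambda>n. \<Sum>k\<le>n. nc_const ((v ^ k) $ n) * a ^ k)"

section \<open>Scalar series are central, and functionals are linear over them\<close>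

lemma nc_const_simps [simp]:
  "nc_const 0 = 0" "nc_const 1 = 1"
  "nc_const (a + b) = nc_const a + nc_const b"
  "nc_const (a * b) = nc_const a * nc_const b"
  by (simp_all add: nc_const_def single_add mult_single)

lemma nc_const_sum: "nc_const (sum f A) = (\<Sum>x\<in>A. nc_const (f x))"
  by (induction A rule: infinite_finite_induct) simp_all

text \<open>A constant sits on the empty word, which is neutral on both sides; the general case adds
  one monomial at a time.\<close>

lemma nc_const_commute: "nc_const c * p = p * nc_const c"
proof (induction p rule: Poly_Mapping.update_induct)
  case const
  then show ?case by simp
next
  case (update p k v)
  then have "Poly_Mapping.update k v p = p + Poly_Mapping.single k v"
    by (intro poly_mapping_eqI) (auto simp: lookup_update lookup_add lookup_single in_keys_iff when_def)
  moreover have "nc_const c * Poly_Mapping.single k v = Poly_Mapping.single k v * nc_const c"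
    by (simp add: nc_const_def mult_single mult.commute)
  ultimately show ?case
    using update by (simp add: algebra_simps)
qed

lemma fps_scalar_simps [simp]:
  "fps_scalar 1 = 1" "fps_scalar (f * g) = fps_scalar f * fps_scalar g"
  "fps_scalar (f + g) = fps_scalar f + fps_scalar g"
  by (rule fps_ext; simp add: fps_scalar_def fps_mult_nth nc_const_sum)+

lemma fps_scalar_nth [simp]: "fps_scalar f $ n = nc_const (f $ n)"
  by (simp add: fps_scalar_def)

lemma fps_scalar_commute: "fps_scalar f * P = P * fps_scalar f"
proof (rule fps_ext)
  fix n
  have "(fps_scalar f * P) $ n = (\<Sum>i=0..n. P $ (n - i) * nc_const (f $ i))"
    by (simp add: fps_mult_nth nc_const_commute)
  also have "\<dots> = (\<Sum>i=0..n. P $ i * nc_const (f $ (n - i)))"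
    by (rule sum.reindex_bij_witness[of _ "\<lambda>i. n - i" "\<lambda>i. n - i"]) auto
  finally show "(fps_scalar f * P) $ n = (P * fps_scalar f) $ n"
    by (simp add: fps_mult_nth)
qed

lemma fps_scalar_left_commute: "P * (fps_scalar f * Q) = fps_scalar f * (P * Q)"
  by (simp only: mult.assoc[symmetric] fps_scalar_commute[of f P])

lemma fps_scalar_mult_mult:
  "fps_scalar f * P * (fps_scalar g * Q) = fps_scalar (f * g) * (P * Q)"
  unfolding fps_scalar_simps mult.assoc fps_scalar_left_commute[of P] ..

lemma unital_functionalD:
  assumes "unital_functional \<phi>"
  shows "\<phi> 1 = 1" "\<phi> (p + q) = \<phi> p + \<phi> q" "\<phi> (nc_const c * p) = c * \<phi> p" "\<phi> 0 = 0"
    "\<phi> (- p) = - \<phi> p" "\<phi> (p - q) = \<phi> p - \<phi> q" "\<phi> (nc_const c) = c"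
    "\<phi> (sum f A) = (\<Sum>x\<in>A. \<phi> (f x))"
proof -
  show *: "\<phi> 1 = 1" "\<phi> (nc_const c * p) = c * \<phi> p" for c p
    using assms by (auto simp: unital_functional_def)
  show add: "\<phi> (p + q) = \<phi> p + \<phi> q" for p q
    using assms by (auto simp: unital_functional_def)
  show zero: "\<phi> 0 = 0"
    using add[of 0 0] by simp
  show minus: "\<phi> (- p) = - \<phi> p" for p
    using add[of p "- p"] zero by (simp add: add_eq_0_iff)
  show "\<phi> (p - q) = \<phi> p - \<phi> q"
    using add[of p "- q"] minus[of q] by simp
  show "\<phi> (nc_const c) = c"
    using *(2)[of c 1] *(1) by simp
  show "\<phi> (sum f A) = (\<Sum>x\<in>A. \<phi> (f x))"
    by (induction A rule: infinite_finite_induct) (simp_all add: add zero)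
qed

lemma fps_functional_nth [simp]: "fps_functional \<phi> P $ n = \<phi> (P $ n)"
  by (simp add: fps_functional_def)

lemma fps_functional_scalar:
  assumes "unital_functional \<phi>"
  shows "fps_functional \<phi> (fps_scalar f * P) = f * fps_functional \<phi> P"
  by (rule fps_ext) (simp add: fps_mult_nth unital_functionalD[OF assms])

section \<open>Formal resolvents\<close>

text \<open>Multiplication by \<open>v a\<close> shifts the index of the geometric series by
  one.\<close>

lemma fps_resolvent_inverse:
  assumes v: "v $ 0 = 0"
  shows "(1 - fps_scalar v * fps_const a) * fps_resolvent v a = 1"
proof (rule fps_ext)
  fix n
  have zero: "(v ^ k) $ n = 0" if "n < k" for n k
    using startsby_zero_power_prefix[OF v] that by blast
  \<comment> \<open>The truncation at \<open>n\<close> may be moved to any \<open>N \<ge> n\<close>.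
    Coefficients entering a product are truncated at different points and have to be summed over a
    common range.\<close>
  have ext: "fps_resolvent v a $ n = (\<Sum>k\<le>N. nc_const ((v ^ k) $ n) * a ^ k)" if "n \<le> N" for n N
    unfolding fps_resolvent_def fps_nth_Abs_fps
    by (rule sum.mono_neutral_left) (use that zero in auto)
  have "(fps_scalar v * fps_const a * fps_resolvent v a) $ n
      = (\<Sum>i=0..n. nc_const (v $ i) * a * (\<Sum>k\<le>n. nc_const ((v ^ k) $ (n - i)) * a ^ k))"
    unfolding fps_mult_nth by (intro sum.cong) (simp_all add: ext[where N = n] mult_delta_right)
  also have "\<dots> = (\<Sum>i=0..n. \<Sum>k\<le>n. nc_const (v $ i * (v ^ k) $ (n - i)) * a ^ Suc k)"
    unfolding sum_distrib_left
  proof (intro sum.cong refl)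
    fix i k
    have "nc_const (v $ i) * a * (nc_const (v ^ k $ (n - i)) * a ^ k)
        = nc_const (v $ i) * (a * nc_const (v ^ k $ (n - i))) * a ^ k"
      by (simp only: mult.assoc)
    also have "a * nc_const (v ^ k $ (n - i)) = nc_const (v ^ k $ (n - i)) * a"
      by (rule nc_const_commute[symmetric])
    finally show "nc_const (v $ i) * a * (nc_const (v ^ k $ (n - i)) * a ^ k)
      = nc_const (v $ i * (v ^ k) $ (n - i)) * a ^ Suc k"
      by (simp add: mult.assoc)
  qed
  also have "\<dots> = (\<Sum>k\<le>n. nc_const ((v ^ Suc k) $ n) * a ^ Suc k)"
    by (subst sum.swap) (simp only: fps_mult_nth power_Suc nc_const_sum sum_distrib_right)
  also have "\<dots> = (\<Sum>k=1..Suc n. nc_const ((v ^ k) $ n) * a ^ k)"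
    by (rule sum.reindex_bij_witness[of _ "\<lambda>k. k - 1" Suc]) auto
  finally have "(fps_scalar v * fps_const a * fps_resolvent v a) $ n
    = (\<Sum>k=1..Suc n. nc_const ((v ^ k) $ n) * a ^ k)" .
  \<comment> \<open>Taken up to \<open>Suc n\<close>, with a vanishing last term, the sum is the
    term \<open>k = 0\<close> plus exactly the sum above.\<close>
  moreover have "fps_resolvent v a $ n
    = nc_const ((1 :: complex fps) $ n) + (\<Sum>k=1..Suc n. nc_const ((v ^ k) $ n) * a ^ k)"
    unfolding ext[OF le_SucI[OF order_refl]] atMost_atLeast0
    by (subst sum.atLeast_Suc_atMost) auto
  ultimately show "((1 - fps_scalar v * fps_const a) * fps_resolvent v a) $ n = 1 $ n"
    by (simp add: algebra_simps)
qed

lemma fps_resolvent_inverse':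
  assumes v: "v $ 0 = 0"
  shows "fps_resolvent v a * (1 - fps_scalar v * fps_const a) = 1"
proof -
  have "nc_const c * a ^ k * a = a * (nc_const c * a ^ k)" for c k
    by (metis mult.assoc nc_const_commute power_commutes)
  then have "fps_resolvent v a * fps_const a = fps_const a * fps_resolvent v a"
    by (intro fps_ext) (simp add: fps_resolvent_def sum_distrib_left sum_distrib_right)
  then have "fps_resolvent v a * (fps_scalar v * fps_const a) = fps_scalar v * fps_const a * fps_resolvent v a"
    by (simp only: fps_scalar_left_commute mult.assoc)
  then show ?thesis
    using fps_resolvent_inverse[OF v, of a] by (simp add: algebra_simps)
qed

lemma fps_mult_nth_below:
  fixes f g :: "'a :: semiring_0 fps"
  assumes "\<And>i. i < m \<Longrightarrow> f $ i = 0" "\<And>i. i < n \<Longrightarrow> g $ i = 0" "k < m + n"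
  shows "(f * g) $ k = 0"
  unfolding fps_mult_nth
proof (rule sum.neutral, rule ballI)
  fix i assume "i \<in> {0..k}"
  then consider "i < m" | "k - i < n"
    using assms(3) by force
  then show "f $ i * g $ (k - i) = 0"
    using assms(1,2) by cases auto
qed

lemma fps_power_nth_below:
  fixes f :: "'a :: semiring_1 fps"
  assumes "f $ 0 = 0"
  shows "i < n \<Longrightarrow> (f ^ n) $ i = 0"
proof (induction n arbitrary: i)
  case (Suc n)
  then show ?case
    using assms by (auto intro!: fps_mult_nth_below[where m = 1 and n = n])
qed simp

text \<open>For \<open>v = 1 / z\<close> the right side is \<open>z\<close> times the Cauchy
  transform of \<open>M\<close> at \<open>z\<close>.\<close>

lemma fps_functional_resolvent:
  assumes \<phi>: "unital_functional \<phi>" "has_law \<phi> a M" and v: "v $ 0 = 0"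
  shows "fps_functional \<phi> (fps_resolvent v a) = moment_fps M oo v"
proof (rule fps_ext)
  fix n
  have "\<phi> (fps_resolvent v a $ n) = (\<Sum>k\<le>n. (v ^ k) $ n * complex_of_real (\<integral>x. x ^ k \<partial>M))"
    using \<phi>(2) by (simp add: fps_resolvent_def unital_functionalD[OF \<phi>(1)] has_law_def)
  then show "fps_functional \<phi> (fps_resolvent v a) $ n = (moment_fps M oo v) $ n"
    by (simp add: fps_compose_nth moment_fps_def mult.commute atMost_atLeast0)
qed

text \<open>Freeness speaks of polynomials in one variable; this makes it applicable to the
  coefficients of a normalised resolvent.\<close>

lemma fps_scalar_resolvent_nth:
  "\<exists>p. (fps_scalar c * fps_resolvent v a) $ n = nc_eval p a"
proof -
  have eval: "(\<Sum>k\<le>N. nc_const (g k) * a ^ k) = nc_eval (\<Sum>k\<le>N. monom (g k) k) a" for g N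
  proof -
    define p where "p = (\<Sum>k\<le>N. monom (g k) k)"
    have coeff: "coeff p k = (if k \<le> N then g k else 0)" for k
      by (simp add: p_def coeff_sum)
    then have "degree p \<le> N"
      by (intro degree_le) auto
    then have "nc_eval p a = (\<Sum>k\<le>N. nc_const (coeff p k) * a ^ k)"
      unfolding nc_eval_def by (intro sum.mono_neutral_left) (auto simp: coeff_eq_0)
    then show ?thesis
      by (simp add: p_def[symmetric] coeff)
  qed
  have "(fps_scalar c * fps_resolvent v a) $ n
      = (\<Sum>i=0..n. \<Sum>k\<le>n - i. nc_const (c $ i * (v ^ k) $ (n - i)) * a ^ k)"
    by (simp add: fps_mult_nth fps_resolvent_def sum_distrib_left mult.assoc)
  \<comment> \<open>Padding with zeros to the common range \<open>k \<le> n\<close> lets the sums be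
    swapped and collected by powers of \<open>a\<close>.\<close>
  also have "\<dots> = (\<Sum>i=0..n. \<Sum>k\<le>n. nc_const (if k \<le> n - i then c $ i * (v ^ k) $ (n - i) else 0) * a ^ k)"
    by (intro sum.cong refl sum.mono_neutral_cong_left) auto
  also have "\<dots> = (\<Sum>k\<le>n. nc_const (\<Sum>i=0..n. if k \<le> n - i then c $ i * (v ^ k) $ (n - i) else 0) * a ^ k)"
    by (subst sum.swap) (simp only: nc_const_sum sum_distrib_right)
  finally show ?thesis
    unfolding eval by blast
qed

section \<open>Alternating products of centred series\<close>

text \<open>The vanishing constant coefficient makes powers of products have growing order, so that
  geometric series in them may be truncated. The rest is what freeness asks of each factor.\<close>

definition centred_fps :: "(nc_poly \<Rightarrow> complex) \<Rightarrow> nc_var \<Rightarrow> nc_poly fps \<Rightarrow> bool" where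
  "centred_fps \<phi> i f \<longleftrightarrow> f $ 0 = 0 \<and> (\<forall>n. \<exists>p. f $ n = nc_eval p (nc_var i) \<and> \<phi> (f $ n) = 0)"

text \<open>A coefficient of a product of series is a sum of products of coefficients. The factors
  are expanded one at a time; \<open>ps\<close> holds the coefficients chosen so far, and freeness
  applies once \<open>fs\<close> is used up.\<close>

lemma centred_prod_list_aux:
  assumes \<phi>: "unital_functional \<phi>" "free_variables \<phi>"
    and "\<forall>(i, f) \<in> set fs. centred_fps \<phi> i f" "\<forall>(i, p) \<in> set ps. \<phi> (nc_eval p (nc_var i)) = 0"
    and "distinct_adj (map fst ps @ map fst fs)" "ps \<noteq> [] \<or> fs \<noteq> []"
  shows "\<phi> (prod_list (map (\<lambda>(i, p). nc_eval p (nc_var i)) ps) * prod_list (map snd fs) $ n) = 0"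
  using assms(3-)
proof (induction fs arbitrary: ps n)
  case Nil
  then have "\<phi> (prod_list (map (\<lambda>(i, p). nc_eval p (nc_var i)) ps)) = 0"
    using \<phi>(2) by (auto simp: free_variables_def)
  then show ?case
    by (simp add: unital_functionalD[OF \<phi>(1)])
next
  case (Cons f fs)
  obtain i g where f: "f = (i, g)" by (cases f)
  let ?L = "prod_list (map (\<lambda>(i, p). nc_eval p (nc_var i)) ps)"
  have "\<phi> (?L * (g $ j * prod_list (map snd fs) $ (n - j))) = 0" for j
  proof -
    obtain p where p: "g $ j = nc_eval p (nc_var i)" "\<phi> (nc_eval p (nc_var i)) = 0"
      using Cons.prems(1) f by (fastforce simp: centred_fps_def)
    show ?thesis
      using Cons.IH[of "ps @ [(i, p)]" "n - j"] Cons.prems p f by (auto simp: mult.assoc)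
  qed
  then show ?case
    by (simp add: f fps_mult_nth sum_distrib_left unital_functionalD[OF \<phi>(1)])
qed

lemma centred_prod_list:
  assumes "unital_functional \<phi>" "free_variables \<phi>"
    and "\<forall>(i, f) \<in> set fs. centred_fps \<phi> i f" "distinct_adj (map fst fs)" "fs \<noteq> []"
  shows "\<phi> (prod_list (map snd fs) $ n) = 0"
  using centred_prod_list_aux[OF assms(1,2), of fs "[]" n] assms by simp

text \<open>The truncated series \<open>\<Sum>\<^bsub>k \<le> N\<^esub> (a b)\<^sup>k\<close> sandwiched between \<open>1 + b\<close> and \<open>1 + a\<close> has
  only alternating products of \<open>a\<close> and \<open>b\<close>, so only the term \<open>1\<close> contributes.\<close>

lemma functional_alternating_series:
  assumes \<phi>: "unital_functional \<phi>" "free_variables \<phi>"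
    and a: "centred_fps \<phi> VarX a" and b: "centred_fps \<phi> VarY b"
  shows "fps_functional \<phi> ((1 + b) * (\<Sum>k\<le>N. (a * b) ^ k) * (1 + a)) = 1"
proof -
  define w where "w k = concat (replicate k [(VarX, a), (VarY, b)])" for k :: nat
  have w_simps: "w 0 = []" "w (Suc k) = (VarX, a) # (VarY, b) # w k" for k
    by (simp_all add: w_def)
  have prod: "prod_list (map snd (w k)) = (a * b) ^ k" for k
    by (induction k) (simp_all add: w_simps mult.assoc)
  have set: "set (w k) \<subseteq> {(VarX, a), (VarY, b)}" for k
    by (induction k) (auto simp: w_simps)
  \<comment> \<open>The word \<open>X Y ... X Y\<close> stays alternating with \<open>Y\<close> put
    in front and \<open>X\<close> behind. The four terms of the expanded product are this bordered
    word with none, one or both borders removed.\<close>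
  have dist: "distinct_adj (VarY # map fst (w k) @ [VarX])" for k
    by (induction k) (simp_all add: w_simps)
  have dist2: "distinct_adj (map fst (w k) @ [VarX])" for k
    using dist[of k] by (metis distinct_adj_ConsD)
  have dist3: "distinct_adj (VarY # map fst (w k))" "distinct_adj (map fst (w k))" for k
    using dist[of k] dist2[of k] by (metis append_Cons distinct_adj_appendD1)+
  have 1: "fps_functional \<phi> (b * (a * b) ^ k * a) = 0" for k
    using centred_prod_list[OF \<phi>, of "(VarY, b) # w k @ [(VarX, a)]"] a b set[of k] dist[of k]
    by (intro fps_ext) (auto simp: prod mult.assoc)
  have 2: "fps_functional \<phi> (b * (a * b) ^ k) = 0" for k
    using centred_prod_list[OF \<phi>, of "(VarY, b) # w k"] a b set[of k] dist3[of k]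
    by (intro fps_ext) (auto simp: prod mult.assoc)
  have 3: "fps_functional \<phi> ((a * b) ^ k * a) = 0" for k
    using centred_prod_list[OF \<phi>, of "w k @ [(VarX, a)]"] a b set[of k] dist2[of k]
    by (intro fps_ext) (auto simp: prod mult.assoc)
  have 4: "fps_functional \<phi> ((a * b) ^ k) = (if k = 0 then 1 else 0)" for k
  proof (cases k)
    case 0
    then show ?thesis
      by (intro fps_ext) (simp add: unital_functionalD[OF \<phi>(1)])
  next
    case (Suc m)
    then show ?thesis
      using centred_prod_list[OF \<phi>, of "w k"] a b set[of k] dist3[of k] w_simps(2)[of m]
      by (intro fps_ext) (auto simp: prod mult.assoc)
  qed
  have add: "fps_functional \<phi> (P + Q) = fps_functional \<phi> P + fps_functional \<phi> Q" for P Q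
    by (intro fps_ext) (simp add: unital_functionalD[OF \<phi>(1)])
  have "fps_functional \<phi> ((1 + b) * (a * b) ^ k * (1 + a)) = (if k = 0 then 1 else 0)" for k
    unfolding distrib_left distrib_right add mult_1_left mult_1_right by (simp add: 1 2 3 4)
  moreover have "(1 + b) * (\<Sum>k\<le>N. (a * b) ^ k) * (1 + a) = (\<Sum>k\<le>N. (1 + b) * (a * b) ^ k * (1 + a))"
    by (simp add: sum_distrib_left sum_distrib_right)
  moreover have "fps_functional \<phi> (\<Sum>k\<le>N. f k) = (\<Sum>k\<le>N. fps_functional \<phi> (f k))" for f
    by (induction N) (simp_all add: add)
  ultimately show ?thesis
    by simp
qed

text \<open>The functional equation \<open>z = z\<^sub>1 + z\<^sub>2 - 1/g\<close> at a common value \<open>g\<close> of the two Cauchy transforms,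
  in the variables \<open>v = 1/z\<^sub>1\<close>, \<open>w = 1/z\<^sub>2\<close> and \<open>t = 1/z\<close>. With the normalised resolvents
  \<open>a = (1 - v X)\<^sup>-\<^sup>1 / m\<^sub>1\<close> and \<open>b = (1 - w Y)\<^sup>-\<^sup>1 / m\<^sub>2\<close> it rests on the identity
  \<open>a\<^sup>-\<^sup>1 + b\<^sup>-\<^sup>1 - 1 = a\<^sup>-\<^sup>1 (1 - (a - 1) (b - 1)) b\<^sup>-\<^sup>1\<close>, whose left side is
  \<open>(m\<^sub>1 + m\<^sub>2 - 1) (1 - t (X + Y))\<close>.\<close>

theorem moment_fps_free_convolution:
  assumes \<phi>: "unital_functional \<phi>" "free_variables \<phi>"
    and laws: "has_law \<phi> (nc_var VarX) \<mu>" "has_law \<phi> (nc_var VarY) \<nu>"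
      "has_law \<phi> (nc_var VarX + nc_var VarY) \<rho>"
    and v: "v $ 0 = 0" "v * (moment_fps \<mu> oo v) = g"
    and w: "w $ 0 = 0" "w * (moment_fps \<nu> oo w) = g"
    and t: "t $ 0 = 0" "t * ((moment_fps \<mu> oo v) + (moment_fps \<nu> oo w) - 1) = g"
  shows "moment_fps \<rho> oo t = (moment_fps \<mu> oo v) + (moment_fps \<nu> oo w) - 1"
proof -
  define X Y where "X = nc_var VarX" and "Y = nc_var VarY"
  define m1 m2 where "m1 = moment_fps \<mu> oo v" and "m2 = moment_fps \<nu> oo w"
  define d where "d = m1 + m2 - 1"
  have moment0: "moment_fps M $ 0 = 1" if "has_law \<phi> p M" for p M
    using that[unfolded has_law_def, rule_format, of 0] unital_functionalD(1)[OF \<phi>(1)]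
    by (simp add: moment_fps_def)
  have m0: "m1 $ 0 = 1" "m2 $ 0 = 1"
    using laws by (simp_all add: m1_def m2_def moment0)
  define i1 i2 where "i1 = inverse m1" and "i2 = inverse m2"
  have inv: "m1 * i1 = 1" "m2 * i2 = 1" "i1 * m1 = 1" "i2 * m2 = 1"
    using m0 by (simp_all add: i1_def i2_def inverse_mult_eq_1 inverse_mult_eq_1' mult.commute)
  have i0: "i1 $ 0 = 1" "i2 $ 0 = 1"
    using m0 by (simp_all add: i1_def i2_def)
  define A B where "A = fps_scalar i1 * fps_resolvent v X" and "B = fps_scalar i2 * fps_resolvent w Y"
  define A' B' where "A' = fps_scalar m1 * (1 - fps_scalar v * fps_const X)"
    and "B' = fps_scalar m2 * (1 - fps_scalar w * fps_const Y)"
  have A'A: "A' * A = 1"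
  proof -
    have "A' * A = fps_scalar (i1 * m1) * ((1 - fps_scalar v * fps_const X) * fps_resolvent v X)"
      unfolding A_def A'_def by (simp only: fps_scalar_mult_mult mult.commute[of i1] mult.commute[of i2])
    then show ?thesis
      by (simp add: inv fps_resolvent_inverse[OF v(1)])
  qed
  have BB': "B * B' = 1" and B'B: "B' * B = 1"
  proof -
    have "B * B' = fps_scalar (i2 * m2) * (fps_resolvent w Y * (1 - fps_scalar w * fps_const Y))"
      unfolding B_def B'_def by (simp only: fps_scalar_mult_mult mult.commute[of i1] mult.commute[of i2])
    then show "B * B' = 1"
      by (simp add: inv fps_resolvent_inverse'[OF w(1)])
    have "B' * B = fps_scalar (i2 * m2) * ((1 - fps_scalar w * fps_const Y) * fps_resolvent w Y)"
      unfolding B_def B'_def by (simp only: fps_scalar_mult_mult mult.commute[of i1] mult.commute[of i2])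
    then show "B' * B = 1"
      by (simp add: inv fps_resolvent_inverse[OF w(1)])
  qed
  \<comment> \<open>The centred parts. The identity announced above is about \<open>A\<close> and
    \<open>B\<close>, there called \<open>a\<close> and \<open>b\<close>.\<close>
  define a b where "a = A - 1" and "b = B - 1"
  have centred: "centred_fps \<phi> i (fps_scalar c * fps_resolvent u (nc_var i) - 1)"
    if c: "c * (moment_fps M oo u) = 1" "c $ 0 = 1" "u $ 0 = 0"
      and law: "has_law \<phi> (nc_var i) M" for c u i M
  proof -
    let ?R = "fps_scalar c * fps_resolvent u (nc_var i)"
    have "fps_functional \<phi> ?R = 1"
      using c fps_functional_scalar[OF \<phi>(1)] fps_functional_resolvent[OF \<phi>(1) law] by simp
    then have "\<phi> (?R $ n) = 1 $ n" for n
      by (metis fps_functional_nth)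
    moreover have "?R $ 0 = 1"
      using c by (simp add: fps_resolvent_def)
    moreover have zero: "0 = nc_eval 0 (nc_var i)"
      by (simp add: nc_eval_def)
    ultimately show ?thesis
      unfolding centred_fps_def using fps_scalar_resolvent_nth[of c u "nc_var i"]
      by (auto simp: unital_functionalD[OF \<phi>(1)])
  qed
  have a: "centred_fps \<phi> VarX a" and b: "centred_fps \<phi> VarY b"
    unfolding a_def b_def A_def B_def X_def Y_def
    using inv i0 v w laws by (auto intro!: centred simp: m1_def[symmetric] m2_def[symmetric])
  define S where "S = X + Y"
  define T where "T = fps_resolvent t S"
  have T: "T * (1 - fps_scalar t * fps_const S) = 1"
    unfolding T_def by (rule fps_resolvent_inverse'[OF t(1)])
  define D where "D = 1 - fps_scalar t * fps_const S"
  have scalar_diff: "fps_scalar (f - g) = fps_scalar f - fps_scalar g" for f g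
    using fps_scalar_simps(3)[of "f - g" g] by simp
  have sum: "A' + B' - 1 = fps_scalar d * D"
  proof -
    have g: "fps_scalar m1 * fps_scalar v = fps_scalar g" "fps_scalar m2 * fps_scalar w = fps_scalar g"
      "fps_scalar d * fps_scalar t = fps_scalar g"
      using v(2) w(2) t(2) unfolding fps_scalar_simps(2)[symmetric] m1_def m2_def d_def
      by (simp_all add: mult.commute)
    have const: "fps_const S = fps_const X + fps_const Y"
      by (simp add: S_def)
    show ?thesis
      unfolding A'_def B'_def D_def const right_diff_distrib mult.assoc[symmetric] g
      by (simp add: d_def scalar_diff algebra_simps del: fps_const_add)
  qed
  have factor: "A' + B' - 1 = A' * (1 - a * b) * B'"
  proof -
    have "A' * (1 - a * b) * B' = A' * A * B' + A' * (B * B') - A' * A * (B * B')"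
      unfolding a_def b_def by (simp add: algebra_simps)
    then show ?thesis
      by (simp add: A'A BB')
  qed
  have "d $ N = (moment_fps \<rho> oo t) $ N" for N
  proof -
    \<comment> \<open>\<open>B * K * A\<close> inverts \<open>A' * (1 - a * b) * B'\<close> up to an
      error containing \<open>(a * b) ^ Suc N\<close>, which has order above \<open>N\<close> and is
      invisible in coefficient \<open>N\<close>.\<close>
    define K where "K = (\<Sum>k\<le>N. (a * b) ^ k)"
    have geom: "(1 - u) * (\<Sum>k\<le>N. u ^ k) = 1 - u ^ Suc N" for u :: "nc_poly fps"
    proof (induction N)
      case (Suc N)
      have "(1 - u) * (\<Sum>k\<le>Suc N. u ^ k) = (1 - u) * (\<Sum>k\<le>N. u ^ k) + (1 - u) * u ^ Suc N"
        by (simp only: sum.atMost_Suc distrib_left)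
      then show ?case
        unfolding Suc by (simp add: left_diff_distrib)
    qed simp
    have "fps_scalar d * D * (B * K * A) = A' * (1 - a * b) * (B' * B) * K * A"
      unfolding sum[symmetric] factor by (simp only: mult.assoc)
    also have "\<dots> = A' * ((1 - a * b) * K) * A"
      by (simp add: B'B mult.assoc)
    also have "\<dots> = 1 - A' * (a * b) ^ Suc N * A"
      unfolding K_def geom by (simp add: algebra_simps A'A)
    finally have "T * (fps_scalar d * D * (B * K * A)) = T * (1 - A' * (a * b) ^ Suc N * A)"
      by simp
    moreover have "T * (fps_scalar d * D * (B * K * A)) = fps_scalar d * (T * D) * (B * K * A)"
      by (simp only: mult.assoc fps_scalar_left_commute)
    moreover have "T * D = 1"
      using T by (simp only: D_def)
    ultimately have "fps_scalar d * (B * K * A) = T * (1 - A' * (a * b) ^ Suc N * A)"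
      by (simp only: mult_1_right)
    also have "\<dots> = T - T * A' * (a * b) ^ Suc N * A"
      by (simp only: right_diff_distrib mult_1_right mult.assoc)
    finally have "fps_scalar d * (B * K * A) = T - T * A' * (a * b) ^ Suc N * A" .
    \<comment> \<open>Only \<open>1\<close> survives of \<open>B * K * A\<close>, so
      \<open>d\<close> and the expectation of \<open>T\<close> agree up to that error.\<close>
    then have "d * fps_functional \<phi> (B * K * A) = fps_functional \<phi> (T - T * A' * (a * b) ^ Suc N * A)"
      by (metis fps_functional_scalar[OF \<phi>(1)])
    moreover have "fps_functional \<phi> (B * K * A) = 1"
      using functional_alternating_series[OF \<phi> a b, of N] by (simp add: a_def b_def K_def)
    ultimately have "d $ N = \<phi> ((T - T * A' * (a * b) ^ Suc N * A) $ N)"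
      by (metis fps_functional_nth mult_1_right)
    moreover have "(T * A' * (a * b) ^ Suc N * A) $ N = 0"
    proof -
      have P: "((a * b) ^ Suc N) $ i = 0" if "i < Suc N" for i
        using that a by (intro fps_power_nth_below) (simp_all add: centred_fps_def)
      have "(T * A' * (a * b) ^ Suc N) $ i = 0" if "i < Suc N" for i
        by (rule fps_mult_nth_below[where m = 0 and n = "Suc N"]) (use that P in auto)
      then show ?thesis
        by (rule fps_mult_nth_below[where m = "Suc N" and n = 0]) auto
    qed
    ultimately have "d $ N = \<phi> (T $ N)"
      by simp
    also have "\<dots> = fps_functional \<phi> T $ N"
      by simp
    finally show ?thesis
      using fps_functional_resolvent[OF \<phi>(1) laws(3) t(1)] by (simp add: T_def S_def X_def Y_def)
  qed
  then show ?thesis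
    by (intro fps_ext) (simp add: d_def m1_def m2_def)
qed

section \<open>Moments of the semicircle and Marchenko-Pastur laws\<close>

text \<open>Up to constants these are the moments of the semicircle law and, with the index shifted
  by one, those of the Marchenko-Pastur law, whose density has a factor
  \<open>1 / x\<close>.\<close>

definition half_disc_moment :: "real \<Rightarrow> real \<Rightarrow> nat \<Rightarrow> real" where
  "half_disc_moment a b k = integral {a..b} (\<lambda>x. x ^ k * sqrt ((b - x) * (x - a)))"

text \<open>The area of a half disc of diameter \<open>b - a\<close>.\<close>

lemma half_disc_moment_0:
  assumes "a < b"
  shows "half_disc_moment a b 0 = pi * (b - a)\<^sup>2 / 8"
proof -
  define m r where "m = (a + b) / 2" and "r = (b - a) / 2"
  have r: "r > 0" and ab: "a = m - r" "b = m + r"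
    using assms by (simp_all add: m_def r_def field_simps)
  define W where "W x = (b - x) * (x - a)" for x
  have W: "W x = r\<^sup>2 - (x - m)\<^sup>2" for x
    unfolding W_def ab by (simp add: power2_eq_square algebra_simps)
  \<comment> \<open>The classical antiderivative of the half circle. The derivative rules of
    \<open>sqrt\<close> and \<open>arcsin\<close> fail at the end points, hence the interior form of
    the fundamental theorem.\<close>
  define f where "f x = ((x - m) * sqrt (W x) + r\<^sup>2 * arcsin ((x - m) / r)) / 2" for x
  have "((\<lambda>x. sqrt (W x)) has_integral (f b - f a)) {a..b}"
  proof (rule fundamental_theorem_of_calculus_interior)
    show "continuous_on {a..b} f"
      unfolding f_def W_def using r by (intro continuous_intros) (auto simp: ab field_simps)
    fix x assume x: "x \<in> {a<..<b}"
    then have pos: "W x > 0" by (simp add: W_def)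
    have s: "- 1 < (x - m) / r" "(x - m) / r < 1"
      using x r by (auto simp: ab field_simps)
    have "sqrt (1 - ((x - m) / r)\<^sup>2) = sqrt (W x) / r"
    proof -
      have "1 - ((x - m) / r)\<^sup>2 = W x / r\<^sup>2"
        using r by (simp add: W power_divide field_simps)
      then show ?thesis
        using r by (simp add: real_sqrt_divide)
    qed
    moreover have "(W has_real_derivative - 2 * (x - m)) (at x)"
      unfolding W by (auto intro!: derivative_eq_intros)
    ultimately have "(f has_real_derivative
        ((x - m) * (- 2 * (x - m) * inverse (sqrt (W x)) / 2) + sqrt (W x)
          + r\<^sup>2 * (1 / r / (sqrt (W x) / r))) / 2) (at x)"
      unfolding f_def using s pos r
      by (auto intro!: derivative_eq_intros simp: field_simps)
    also have "((x - m) * (- 2 * (x - m) * inverse (sqrt (W x)) / 2) + sqrt (W x)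
          + r\<^sup>2 * (1 / r / (sqrt (W x) / r))) / 2 = sqrt (W x)"
    proof -
      have "sqrt (W x) * sqrt (W x) = r\<^sup>2 - (x - m)\<^sup>2"
        using pos W by simp
      then show ?thesis
        using pos r by (simp add: field_simps power2_eq_square)
    qed
    finally show "(f has_vector_derivative sqrt (W x)) (at x)"
      by (simp add: has_real_derivative_iff_has_vector_derivative)
  qed (use assms in simp)
  moreover have "f b - f a = pi * (b - a)\<^sup>2 / 8"
    using r by (simp add: f_def W_def ab power2_eq_square field_simps)
  ultimately show ?thesis
    unfolding half_disc_moment_def by (simp add: W_def integral_unique)
qed

text \<open>Integrate the derivative of \<open>x\<^sup>k ((b - x) (x - a))\<^sup>3\<^sup>/\<^sup>2\<close>.\<close>

lemma half_disc_moment_recurrence: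
  assumes "a < b"
  shows "(real k + 3) * half_disc_moment a b (Suc k)
    = (a + b) * (real k + 3 / 2) * half_disc_moment a b k - a * b * real k * half_disc_moment a b (k - 1)"
proof -
  define W where "W x = (b - x) * (x - a)" for x
  define f where "f x = x ^ k * (W x * sqrt (W x))" for x
  define g where "g j x = x ^ j * sqrt (W x)" for j x
  have int: "(g j has_integral half_disc_moment a b j) {a..b}" for j
    unfolding half_disc_moment_def g_def W_def
    by (intro integrable_integral integrable_continuous_real continuous_intros)
  let ?h = "\<lambda>x. (a + b) * (real k + 3 / 2) * g k x - (real k + 3) * g (Suc k) x - a * b * real k * g (k - 1) x"
  have "(?h has_integral f b - f a) {a..b}"
  proof (rule fundamental_theorem_of_calculus_interior)
    show "continuous_on {a..b} f"
      unfolding f_def W_def by (intro continuous_intros)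
    fix x assume x: "x \<in> {a<..<b}"
    then have pos: "W x > 0" by (simp add: W_def)
    define q where "q = sqrt (W x)"
    have W': "(W has_real_derivative a + b - 2 * x) (at x)"
      unfolding W_def by (auto intro!: derivative_eq_intros simp: algebra_simps)
    have sq: "W x / sqrt (W x) = sqrt (W x)"
      using pos by (simp add: real_div_sqrt)
    have "(f has_real_derivative real k * x ^ (k - 1) * (W x * sqrt (W x))
        + x ^ k * ((a + b - 2 * x) * sqrt (W x) + (a + b - 2 * x) / 2 * (W x / sqrt (W x)))) (at x)"
      unfolding f_def using pos
      by (auto intro!: derivative_eq_intros W' simp: divide_simps)
    also have "real k * x ^ (k - 1) * (W x * sqrt (W x))
        + x ^ k * ((a + b - 2 * x) * sqrt (W x) + (a + b - 2 * x) / 2 * (W x / sqrt (W x))) = ?h x"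
    proof (cases k)
      case 0
      then show ?thesis unfolding sq g_def by (simp add: field_simps)
    next
      case (Suc j)
      then show ?thesis
        unfolding sq g_def unfolding q_def[symmetric] by (simp add: W_def field_simps)
    qed
    finally show "(f has_vector_derivative ?h x) (at x)"
      by (simp add: has_real_derivative_iff_has_vector_derivative)
  qed (use assms in simp)
  moreover have "(?h has_integral (a + b) * (real k + 3 / 2) * half_disc_moment a b k
      - (real k + 3) * half_disc_moment a b (Suc k) - a * b * real k * half_disc_moment a b (k - 1)) {a..b}"
    by (intro has_integral_diff has_integral_mult_right int)
  ultimately have "f b - f a = (a + b) * (real k + 3 / 2) * half_disc_moment a b k
      - (real k + 3) * half_disc_moment a b (Suc k) - a * b * real k * half_disc_moment a b (k - 1)"
    by (rule has_integral_unique)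
  then show ?thesis
    by (simp add: f_def W_def)
qed

text \<open>\<open>D\<^sup>2\<close> and \<open>R\<close> solve the same linear equation
  \<open>R y' = R' y\<close>, so their quotient has derivative zero, and its constant coefficient is
  1.\<close>

lemma fps_square_eqI:
  fixes D R :: "'a :: field_char_0 fps"
  assumes ode: "2 * R * fps_deriv D = fps_deriv R * D" and "D $ 0 = 1" "R $ 0 = 1"
  shows "D\<^sup>2 = R"
proof -
  define I where "I = inverse R"
  have RI: "R * I = 1"
    using assms(3) by (simp add: I_def inverse_mult_eq_1')
  have I': "fps_deriv I = - fps_deriv R * I\<^sup>2"
    unfolding I_def using assms(3) by (intro fps_inverse_deriv) simp
  have "fps_deriv (D\<^sup>2 * I) = 2 * D * fps_deriv D * I - D\<^sup>2 * fps_deriv R * I\<^sup>2"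
    by (simp add: I' power2_eq_square algebra_simps)
  also have "\<dots> = D * I\<^sup>2 * (2 * R * fps_deriv D - fps_deriv R * D) + 2 * D * fps_deriv D * I * (1 - R * I)"
    by (simp add: power2_eq_square algebra_simps)
  also have "\<dots> = 0"
    by (simp add: ode RI)
  finally have "D\<^sup>2 * I = fps_const ((D\<^sup>2 * I) $ 0)"
    by (simp only: fps_deriv_eq_0_iff)
  also have "(D\<^sup>2 * I) $ 0 = 1"
    using assms by (simp add: I_def power2_eq_square)
  finally have "D\<^sup>2 * I * R = R"
    by simp
  then show ?thesis
    using RI by (simp add: mult.assoc mult.commute[of I R])
qed

text \<open>The recurrence says that \<open>D = 1 - s t / 2 - c t\<^sup>2 N(t)\<close>, for the generating series \<open>N\<close> of the
  moments, solves the same linear equation as the square root of \<open>R = 1 - s t + p t\<^sup>2\<close>.\<close>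

lemma half_disc_recurrence_square:
  fixes n :: "nat \<Rightarrow> 'a :: field_char_0"
  assumes rec: "\<And>k. (of_nat k + 3) * n (Suc k) = s * (of_nat k + 3 / 2) * n k - p * of_nat k * n (k - 1)"
    and c: "2 * c * n 0 = s\<^sup>2 / 4 - p"
  shows "(1 - fps_const (s / 2) * fps_X - fps_const c * fps_X\<^sup>2 * Abs_fps n)\<^sup>2
    = 1 - fps_const s * fps_X + fps_const p * fps_X\<^sup>2"
proof (rule fps_square_eqI)
  define N where "N = Abs_fps n"
  define N' where "N' = fps_deriv N"
  define X :: "'a fps" where "X = fps_X"
  define S P C where "S = fps_const s" and "P = fps_const p" and "C = fps_const c"
  \<comment> \<open>Coefficient \<open>Suc k\<close> is twice the recurrence; the term
    \<open>4 n 0\<close> makes coefficient 0 vanish on both sides.\<close>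
  have ode: "2 * X * (1 - S * X + P * X\<^sup>2) * N' = 4 * fps_const (n 0) - (4 - 3 * S * X + 2 * P * X\<^sup>2) * N"
  proof (rule fps_ext)
    fix j
    have N_nth: "N $ k = n k" "N' $ k = of_nat (Suc k) * n (Suc k)" for k
      by (simp_all add: N_def N'_def)
    have L: "2 * X * (1 - S * X + P * X\<^sup>2) * N'
        = fps_const 2 * (X * N') - fps_const (2 * s) * (X ^ 2 * N') + fps_const (2 * p) * (X ^ 3 * N')"
      by (simp add: S_def P_def fps_numeral_fps_const power2_eq_square power3_eq_cube algebra_simps
          flip: fps_const_mult)
    have R: "4 * fps_const (n 0) - (4 - 3 * S * X + 2 * P * X\<^sup>2) * N
        = fps_const (4 * n 0) - fps_const 4 * N + fps_const (3 * s) * (X * N) - fps_const (2 * p) * (X ^ 2 * N)"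
      by (simp add: S_def P_def fps_numeral_fps_const algebra_simps flip: fps_const_mult)
    show "(2 * X * (1 - S * X + P * X\<^sup>2) * N') $ j = (4 * fps_const (n 0) - (4 - 3 * S * X + 2 * P * X\<^sup>2) * N) $ j"
    proof (cases j)
      case 0
      then show ?thesis unfolding L R by (simp add: X_def N_nth fps_X_power_mult_nth)
    next
      case (Suc k)
      have rec2: "2 * ((of_nat k + 3) * n (Suc k))
          = 2 * (s * (of_nat k + 3 / 2) * n k - p * of_nat k * n (k - 1))"
        using rec[of k] by simp
      show ?thesis
      proof (cases k)
        case 0
        then show ?thesis
          using rec2 Suc unfolding L R by (simp add: X_def N_nth fps_X_power_mult_nth algebra_simps)
      next
        case (Suc i)
        then show ?thesis
          using rec2 \<open>j = Suc k\<close> unfolding L R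
          by (cases i) (simp_all only: X_def fps_add_nth fps_sub_nth fps_mult_left_const_nth
              fps_X_mult_nth fps_X_power_mult_nth N_nth fps_nth_fps_const, simp_all add: algebra_simps)
      qed
    qed
  qed
  define H where "H = fps_const (s / 2)"
  have S: "S = 2 * H"
    by (simp add: S_def H_def fps_numeral_fps_const)
  \<comment> \<open>The condition on \<open>c\<close> is agreement of the claim at
    \<open>t^2\<close>; it absorbs the constant left over by \<open>ode\<close>.\<close>
  have c': "2 * (C * fps_const (n 0)) = H\<^sup>2 - P"
    using c by (simp add: C_def H_def P_def fps_numeral_fps_const power2_eq_square algebra_simps)
  let ?D = "1 - H * X - C * X\<^sup>2 * N" and ?R = "1 - S * X + P * X\<^sup>2"
  have D': "fps_deriv ?D = - H - 2 * C * X * N - C * X\<^sup>2 * N'"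
    by (simp add: H_def C_def X_def N'_def power2_eq_square algebra_simps)
  have R': "fps_deriv ?R = 2 * P * X - S"
    by (simp add: S_def P_def X_def power2_eq_square algebra_simps)
  have "2 * ?R * fps_deriv ?D = - 2 * H * ?R - 4 * C * X * N * ?R
      - C * X * (2 * X * ?R * N')"
    unfolding D' by (simp add: power2_eq_square algebra_simps)
  also have "\<dots> = - 2 * H * ?R - 4 * C * X * N * ?R + C * X * (4 - 3 * S * X + 2 * P * X\<^sup>2) * N
      - 2 * X * (2 * (C * fps_const (n 0)))"
    unfolding ode by (simp add: power2_eq_square algebra_simps)
  also have "\<dots> = fps_deriv ?R * ?D"
    unfolding R' c' unfolding S by (simp add: power2_eq_square algebra_simps)
  finally show "2 * (1 - fps_const s * fps_X + fps_const p * fps_X\<^sup>2)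
      * fps_deriv (1 - fps_const (s / 2) * fps_X - fps_const c * fps_X\<^sup>2 * Abs_fps n)
    = fps_deriv (1 - fps_const s * fps_X + fps_const p * fps_X\<^sup>2)
      * (1 - fps_const (s / 2) * fps_X - fps_const c * fps_X\<^sup>2 * Abs_fps n)"
    by (simp add: H_def S_def P_def C_def X_def N_def)
qed (simp_all add: power2_eq_square)

section \<open>Moments of the two laws as half-disc moments\<close>

lemma lborel_integral_atLeastAtMost:
  fixes f :: "real \<Rightarrow> real"
  assumes "continuous_on {a..b} f"
  shows "(\<integral>x. f x * indicator {a..b} x \<partial>lborel) = integral {a..b} f"
  using set_borel_integral_eq_integral(2)[OF borel_integrable_atLeastAtMost'[OF assms]]
  by (simp add: set_lebesgue_integral_def mult.commute)

lemma semicircle_moment: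
  assumes "\<beta> > 0"
  shows "(\<integral>x. x ^ k \<partial>semicircle_law \<beta>) = half_disc_moment (- 2 * \<beta>) (2 * \<beta>) k / (2 * pi * \<beta>\<^sup>2)"
proof -
  let ?c = "1 / (2 * pi * \<beta>\<^sup>2)"
  have "(\<integral>x. x ^ k \<partial>semicircle_law \<beta>)
      = (\<integral>x. ?c * sqrt (4 * \<beta>\<^sup>2 - x\<^sup>2) * indicator {- 2 * \<beta> .. 2 * \<beta>} x * x ^ k \<partial>lborel)"
    unfolding semicircle_law_def
  proof (rule integral_real_density)
    have "0 \<le> ?c * sqrt (4 * \<beta>\<^sup>2 - x\<^sup>2) * indicator {- 2 * \<beta> .. 2 * \<beta>} x" for x
    proof (cases "x \<in> {- 2 * \<beta> .. 2 * \<beta>}")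
      case True
      then have "x\<^sup>2 \<le> (2 * \<beta>)\<^sup>2"
        by (intro power2_le_iff_abs_le[THEN iffD2]) (use assms in auto)
      then show ?thesis
        using assms by (simp add: power_mult_distrib)
    qed simp
    then show "AE x in lborel. 0 \<le> ?c * sqrt (4 * \<beta>\<^sup>2 - x\<^sup>2) * indicator {- 2 * \<beta> .. 2 * \<beta>} x"
      by simp
  qed measurable
  also have "\<dots> = (\<integral>x. ?c * (x ^ k * sqrt ((2 * \<beta> - x) * (x - - 2 * \<beta>)) * indicator {- 2 * \<beta> .. 2 * \<beta>} x) \<partial>lborel)"
    by (intro Bochner_Integration.integral_cong) (auto simp: power2_eq_square algebra_simps)
  also have "\<dots> = ?c * half_disc_moment (- 2 * \<beta>) (2 * \<beta>) k"
    unfolding half_disc_moment_def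
    by (subst integral_mult_right_zero, subst lborel_integral_atLeastAtMost)
      (auto intro!: continuous_intros)
  finally show ?thesis
    by simp
qed

lemma mp_edges:
  assumes "\<beta> > 0"
  shows "0 \<le> mp_lower \<beta>" "mp_lower \<beta> < mp_upper \<beta>"
    "mp_lower \<beta> + mp_upper \<beta> = 2 * (1 + \<beta>)" "mp_lower \<beta> * mp_upper \<beta> = (1 - \<beta>)\<^sup>2"
    "mp_upper \<beta> - mp_lower \<beta> = 4 * sqrt \<beta>"
proof -
  show "0 \<le> mp_lower \<beta>"
    by (simp add: mp_lower_def)
  show "mp_lower \<beta> * mp_upper \<beta> = (1 - \<beta>)\<^sup>2"
  proof -
    have "mp_lower \<beta> * mp_upper \<beta> = (1 - sqrt \<beta> * sqrt \<beta>)\<^sup>2"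
      unfolding mp_lower_def mp_upper_def power_mult_distrib[symmetric] by (simp add: algebra_simps)
    then show ?thesis
      using assms by simp
  qed
qed (use assms in \<open>simp_all add: mp_lower_def mp_upper_def power2_eq_square algebra_simps\<close>)

lemma mp_density_nonneg:
  assumes "\<beta> > 0"
  shows "0 \<le> mp_density \<beta> x"
  using mp_edges(1)[OF assms] by (auto simp: mp_density_def indicator_def)

text \<open>A positive power vanishes at 0, so the atom drops out, and one factor \<open>x\<close>
  cancels the \<open>1 / x\<close> of the density.\<close>

lemma marchenko_pastur_moment:
  assumes "\<beta> > 0"
  shows "(\<integral>x. x ^ Suc k \<partial>marchenko_pastur_law \<beta>)
    = half_disc_moment (mp_lower \<beta>) (mp_upper \<beta>) k / (2 * pi)"
proof -
  let ?M = "marchenko_pastur_law \<beta>" and ?L = "density lborel (\<lambda>x. ennreal (mp_density \<beta> x))"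
  have [measurable]: "mp_density \<beta> \<in> borel_measurable borel"
    unfolding mp_density_def[abs_def] by measurable
  have meas: "measurable ?M N = measurable borel N" for N :: "real measure"
    by (intro measurable_cong_sets) auto
  have eq: "density ?M (\<lambda>x. ennreal (indicator (- {0}) x)) = ?L"
  proof (rule measure_eqI)
    fix A assume "A \<in> sets (density ?M (\<lambda>x. ennreal (indicator (- {0}) x)))"
    then have A[measurable]: "A \<in> sets borel" by simp
    have "emeasure (density ?M (\<lambda>x. ennreal (indicator (- {0}) x))) A = (\<integral>\<^sup>+x. indicator (A - {0}) x \<partial>?M)"
    proof (subst emeasure_density)
      show "(\<integral>\<^sup>+x. ennreal (indicator (- {0}) x) * indicator A x \<partial>?M) = (\<integral>\<^sup>+x. indicator (A - {0}) x \<partial>?M)"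
        by (intro nn_integral_cong) (auto simp: indicator_def)
    qed (simp_all add: meas)
    also have "\<dots> = emeasure ?M (A - {0})"
      by (rule nn_integral_indicator) auto
    also have "\<dots> = emeasure ?L (A - {0})"
      by (subst emeasure_marchenko_pastur_law) (auto simp: emeasure_return)
    also have "\<dots> = emeasure ?L A"
    proof (rule emeasure_eq_AE)
      have "AE x in lborel. x \<noteq> (0 :: real)"
        by (rule AE_lborel_singleton)
      then show "AE x in ?L. x \<in> A - {0} \<longleftrightarrow> x \<in> A"
        by (subst AE_density) auto
    qed auto
    finally show "emeasure (density ?M (\<lambda>x. ennreal (indicator (- {0}) x))) A = emeasure ?L A" .
  qed simp
  have "(\<integral>x. x ^ Suc k \<partial>?M) = (\<integral>x. indicator (- {0}) x * x ^ Suc k \<partial>?M)"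
    by (intro Bochner_Integration.integral_cong) (auto simp: indicator_def)
  also have "\<dots> = (\<integral>x. x ^ Suc k \<partial>density ?M (\<lambda>x. ennreal (indicator (- {0}) x)))"
    by (rule integral_real_density[symmetric]) (auto simp: meas)
  also have "\<dots> = (\<integral>x. mp_density \<beta> x * x ^ Suc k \<partial>lborel)"
    unfolding eq by (rule integral_real_density) (auto simp: mp_density_nonneg[OF assms])
  also have "\<dots> = (\<integral>x. 1 / (2 * pi) * (x ^ k * sqrt ((mp_upper \<beta> - x) * (x - mp_lower \<beta>))
      * indicator {mp_lower \<beta>..mp_upper \<beta>} x) \<partial>lborel)"
  proof (intro Bochner_Integration.integral_cong refl)
    fix x
    \<comment> \<open>The point 0 lies in the interval only if the lower edge is 0, and then the
      square root vanishes there.\<close>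
    show "mp_density \<beta> x * x ^ Suc k = 1 / (2 * pi) * (x ^ k * sqrt ((mp_upper \<beta> - x) * (x - mp_lower \<beta>))
      * indicator {mp_lower \<beta>..mp_upper \<beta>} x)"
      using mp_edges(1)[OF assms] by (cases "x = 0") (auto simp: mp_density_def indicator_def)
  qed
  also have "\<dots> = 1 / (2 * pi) * half_disc_moment (mp_lower \<beta>) (mp_upper \<beta>) k"
    unfolding half_disc_moment_def
    by (subst integral_mult_right_zero, subst lborel_integral_atLeastAtMost)
      (auto intro!: continuous_intros)
  finally show ?thesis
    by simp
qed

section \<open>Quadratic equations for the moment series\<close>

text \<open>The square of \<open>1 - 2 b t^2 M\<close> is known from the recurrence with
  \<open>s = 0\<close>, \<open>p = - 4 b\<close>, \<open>c = 2 b\<close>; cancelling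
  \<open>4 b t^2\<close> leaves the equation. The mass \<open>M0\<close> gives the initial
  value.\<close>

lemma moment_fps_semicircle:
  assumes "\<beta> > 0" and M0: "moment_fps (semicircle_law \<beta>) $ 0 = 1"
  shows "moment_fps (semicircle_law \<beta>)
    = 1 + fps_const (complex_of_real (\<beta>\<^sup>2)) * fps_X\<^sup>2 * (moment_fps (semicircle_law \<beta>))\<^sup>2"
proof -
  define n where "n k = complex_of_real (half_disc_moment (- 2 * \<beta>) (2 * \<beta>) k / (2 * pi * \<beta>\<^sup>2))" for k
  have M: "moment_fps (semicircle_law \<beta>) = Abs_fps n"
    by (intro fps_ext) (simp add: moment_fps_def n_def semicircle_moment[OF assms(1)])
  define b where "b = complex_of_real (\<beta>\<^sup>2)"
  have rec: "(of_nat k + 3) * n (Suc k) = 0 * (of_nat k + 3 / 2) * n k - (- 4 * b) * of_nat k * n (k - 1)" for k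
  proof -
    have "(real k + 3) * half_disc_moment (- 2 * \<beta>) (2 * \<beta>) (Suc k)
        = 4 * \<beta>\<^sup>2 * real k * half_disc_moment (- 2 * \<beta>) (2 * \<beta>) (k - 1)"
      using half_disc_moment_recurrence[of "- 2 * \<beta>" "2 * \<beta>" k] assms(1)
      by (simp add: power2_eq_square)
    then have "complex_of_real ((real k + 3) * (half_disc_moment (- 2 * \<beta>) (2 * \<beta>) (Suc k) / (2 * pi * \<beta>\<^sup>2)))
        = complex_of_real (4 * \<beta>\<^sup>2 * real k * (half_disc_moment (- 2 * \<beta>) (2 * \<beta>) (k - 1) / (2 * pi * \<beta>\<^sup>2)))"
      by (metis (no_types, lifting) times_divide_eq_right)
    then show ?thesis
      by (simp only: n_def b_def of_real_mult of_real_add of_real_numeral of_real_of_nat_eq) simp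
  qed
  have "2 * (2 * b) * n 0 = 0\<^sup>2 / 4 - (- 4 * b)"
    using M0 by (simp add: M)
  from half_disc_recurrence_square[of n 0 "- 4 * b" "2 * b", OF rec this]
  have "(1 - fps_const (2 * b) * fps_X\<^sup>2 * Abs_fps n)\<^sup>2 = 1 - fps_const (4 * b) * fps_X\<^sup>2"
    by simp
  moreover have "fps_const (2 * b) = 2 * fps_const b" "fps_const (4 * b) = 4 * fps_const b"
    by (simp_all add: fps_numeral_fps_const)
  ultimately have "(1 - 2 * fps_const b * fps_X\<^sup>2 * Abs_fps n)\<^sup>2 = 1 - 4 * fps_const b * fps_X\<^sup>2"
    by (simp only:)
  then have "4 * (fps_const b * fps_X\<^sup>2) * (1 + fps_const b * fps_X\<^sup>2 * (Abs_fps n)\<^sup>2 - Abs_fps n) = 0"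
    by (simp add: power2_eq_square algebra_simps del: fps_const_mult)
  moreover have "b \<noteq> 0"
    using assms by (simp add: b_def)
  ultimately show ?thesis
    by (simp add: M b_def)
qed

text \<open>Because of the index shift \<open>M = 1 + t N\<close> with \<open>N\<close> the
  half-disc series; its initial value \<open>\<beta>\<close> is the area of the half disc over
  \<open>2 pi\<close>.\<close>

lemma moment_fps_marchenko_pastur:
  fixes \<beta> :: real
  defines "M \<equiv> moment_fps (marchenko_pastur_law \<beta>)"
  assumes "\<beta> > 0" and M0: "M $ 0 = 1"
  shows "M - fps_X * M\<^sup>2 = 1 + fps_const (complex_of_real (\<beta> - 1)) * fps_X * M"
proof -
  let ?a = "mp_lower \<beta>" and ?b = "mp_upper \<beta>"
  define n where "n k = complex_of_real (half_disc_moment ?a ?b k / (2 * pi))" for k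
  have M: "M = 1 + fps_X * Abs_fps n"
  proof (rule fps_ext)
    fix k
    show "M $ k = (1 + fps_X * Abs_fps n) $ k"
    proof (cases k)
      case 0
      then show ?thesis using M0 by simp
    next
      case (Suc j)
      then show ?thesis
        by (simp add: M_def moment_fps_def n_def marchenko_pastur_moment[OF assms(2)] del: power_Suc)
    qed
  qed
  define b where "b = complex_of_real \<beta>"
  have rec: "(of_nat k + 3) * n (Suc k)
      = (2 * (1 + b)) * (of_nat k + 3 / 2) * n k - (1 - b)\<^sup>2 * of_nat k * n (k - 1)" for k
  proof -
    have "(real k + 3) * half_disc_moment ?a ?b (Suc k)
        = 2 * (1 + \<beta>) * (real k + 3 / 2) * half_disc_moment ?a ?b k
          - (1 - \<beta>)\<^sup>2 * real k * half_disc_moment ?a ?b (k - 1)"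
      using half_disc_moment_recurrence[of ?a ?b k] mp_edges[OF assms(2)] by simp
    then have "(real k + 3) * (half_disc_moment ?a ?b (Suc k) / (2 * pi))
        = 2 * (1 + \<beta>) * (real k + 3 / 2) * (half_disc_moment ?a ?b k / (2 * pi))
          - (1 - \<beta>)\<^sup>2 * real k * (half_disc_moment ?a ?b (k - 1) / (2 * pi))"
      by (simp add: diff_divide_distrib)
    from arg_cong[OF this, of complex_of_real] show ?thesis
      by (simp only: n_def b_def of_real_mult of_real_add of_real_diff of_real_numeral of_real_of_nat_eq
          of_real_power of_real_1 of_real_divide[of 3 2])
  qed
  have n0: "n 0 = b"
    using half_disc_moment_0[OF mp_edges(2)[OF assms(2)]] assms(2)
    by (simp add: n_def b_def mp_edges power_mult_distrib)
  then have "2 * 2 * n 0 = (2 * (1 + b))\<^sup>2 / 4 - (1 - b)\<^sup>2"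
    by (simp add: power2_eq_square algebra_simps)
  moreover have "2 * (1 + b) / 2 = 1 + b"
    by simp
  ultimately  have *: "(1 - fps_const (1 + b) * fps_X - fps_const 2 * fps_X\<^sup>2 * Abs_fps n)\<^sup>2
      = 1 - fps_const (2 * (1 + b)) * fps_X + fps_const ((1 - b)\<^sup>2) * fps_X\<^sup>2"
    using half_disc_recurrence_square[of n "2 * (1 + b)" "(1 - b)\<^sup>2" 2, OF rec] by metis
  define B where "B = fps_const b"
  define X :: "complex fps" where "X = fps_X"
  have "(1 - (1 + B) * X - 2 * X\<^sup>2 * Abs_fps n)\<^sup>2 = 1 - 2 * (1 + B) * X + (1 - B)\<^sup>2 * X\<^sup>2"
    using * by (simp add: B_def X_def fps_numeral_fps_const power2_eq_square
        flip: fps_const_mult fps_const_add fps_const_sub)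
  moreover have "(1 - (1 + B) * X - 2 * X\<^sup>2 * Abs_fps n) = 1 + (1 - B) * X - 2 * X * M"
    by (simp add: M X_def power2_eq_square algebra_simps)
  ultimately have "(1 + (1 - B) * X - 2 * X * M)\<^sup>2 = 1 - 2 * (1 + B) * X + (1 - B)\<^sup>2 * X\<^sup>2"
    by (simp only:)
  then have "4 * X * (X * M\<^sup>2 - M * (1 + (1 - B) * X) + 1) = 0"
    by (simp add: power2_eq_square algebra_simps)
  then have "X * M\<^sup>2 - M * (1 + (1 - B) * X) + 1 = 0"
    by (simp add: X_def)
  then show ?thesis
    by (simp add: X_def B_def b_def algebra_simps flip: fps_const_sub)
qed

text \<open>Used for two solutions of one quadratic fixed point equation, whose difference
  reproduces itself with a factor of positive order.\<close>

lemma fps_eq_of_contraction: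
  fixes m q :: "'a :: idom fps"
  assumes "m - q = u * (m - q)" "u $ 0 = 0"
  shows "m = q"
proof -
  have "(1 - u) * (m - q) = 0"
    using assms(1) by (simp add: algebra_simps)
  moreover have "1 - u \<noteq> 0"
    using assms(2) by (metis diff_0_right fps_one_nth fps_sub_nth fps_zero_nth zero_neq_one)
  ultimately show ?thesis by simp
qed

text \<open>In terms of the Cauchy transform these say that the R-transforms are \<open>\<beta>\<^sup>2 g\<close> and
  \<open>\<beta> / (1 - g)\<close>.\<close>

lemma moment_fps_semicircle_compose:
  assumes "\<beta> > 0" "moment_fps (semicircle_law \<beta>) $ 0 = 1" "v $ 0 = 0"
    and r: "r = fps_const (complex_of_real (\<beta>\<^sup>2)) * g" and v: "v * (1 + g * r) = g"
  shows "moment_fps (semicircle_law \<beta>) oo v = 1 + g * r"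
proof -
  define m b where "m = moment_fps (semicircle_law \<beta>) oo v" and "b = fps_const (complex_of_real (\<beta>\<^sup>2))"
  have m: "m = 1 + b * v\<^sup>2 * m\<^sup>2"
    using arg_cong[OF moment_fps_semicircle[OF assms(1,2)], of "\<lambda>f. f oo v"] assms(3)
    by (simp add: m_def b_def fps_compose_add_distrib fps_compose_mult_distrib power2_eq_square)
  define q where "q = 1 + g * r"
  \<comment> \<open>The candidate \<open>q\<close> solves the same fixed point equation as
    \<open>m\<close>.\<close>
  have "q = 1 + b * (v * q)\<^sup>2"
    unfolding v[folded q_def] by (simp add: q_def r b_def power2_eq_square algebra_simps)
  then have "m - q = b * v\<^sup>2 * m\<^sup>2 - b * (v * q)\<^sup>2"
    using m by (metis add_diff_cancel_left)
  then have "m - q = b * v\<^sup>2 * (m + q) * (m - q)"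
    by (simp add: power2_eq_square algebra_simps)
  then show ?thesis
    unfolding m_def[symmetric] q_def[symmetric]
    by (rule fps_eq_of_contraction) (simp add: assms(3) power2_eq_square)
qed

lemma moment_fps_marchenko_pastur_compose:
  assumes "\<beta> > 0" "moment_fps (marchenko_pastur_law \<beta>) $ 0 = 1" "v $ 0 = 0"
    and r: "r * (1 - g) = fps_const (complex_of_real \<beta>)" and v: "v * (1 + g * r) = g"
  shows "moment_fps (marchenko_pastur_law \<beta>) oo v = 1 + g * r"
proof -
  define m b where "m = moment_fps (marchenko_pastur_law \<beta>) oo v" and "b = fps_const (complex_of_real \<beta>)"
  have m: "m - v * m\<^sup>2 = 1 + (b - 1) * v * m"
    using arg_cong[OF moment_fps_marchenko_pastur[OF assms(1,2)], of "\<lambda>f. f oo v"] assms(3)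
    by (simp add: m_def b_def fps_compose_add_distrib fps_compose_sub_distrib fps_compose_mult_distrib
        power2_eq_square flip: fps_const_sub)
  define q where "q = 1 + g * r"
  have vq: "v * q = g"
    using v by (simp add: q_def)
  have "q - v * q\<^sup>2 = q - v * q * q"
    by (simp add: power2_eq_square)
  also have "\<dots> = 1 - g + g * (r * (1 - g))"
    unfolding vq by (simp add: q_def algebra_simps)
  also have "\<dots> = 1 + (b - 1) * (v * q)"
    unfolding vq r b_def by (simp add: algebra_simps)
  finally have "q = v * q\<^sup>2 + (1 + (b - 1) * (v * q))"
    by (simp add: diff_eq_eq add.commute)
  moreover from m have "m = v * m\<^sup>2 + (1 + (b - 1) * (v * m))"
    by (simp add: diff_eq_eq add.commute mult.assoc)
  ultimately have "m - q = (v * m\<^sup>2 + (1 + (b - 1) * (v * m))) - (v * q\<^sup>2 + (1 + (b - 1) * (v * q)))"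
    by (metis (no_types))
  also have "\<dots> = (v * (m + q) + (b - 1) * v) * (m - q)"
    by (simp add: power2_eq_square algebra_simps)
  finally have "m - q = (v * (m + q) + (b - 1) * v) * (m - q)" .
  then show ?thesis
    unfolding m_def[symmetric] q_def[symmetric]
    by (rule fps_eq_of_contraction) (simp add: assms(3))
qed

section \<open>The edge of the support as a singularity\<close>

text \<open>The complement of the support is a union of open null sets, and countably many of them
  suffice.\<close>

lemma AE_measure_support:
  assumes "sets M = sets borel"
  shows "AE x in M. x \<in> measure_support M"
proof -
  let ?\<F> = "{U :: real set. open U \<and> emeasure M U = 0}"
  obtain \<F> where \<F>: "\<F> \<subseteq> ?\<F>" "countable \<F>" "\<Union>\<F> = \<Union>?\<F>"
    by (rule Lindelof[of ?\<F>]) auto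
  have "{x \<in> space M. x \<notin> measure_support M} \<subseteq> \<Union>\<F>"
    unfolding \<F>(3) by (auto simp: measure_support_def not_gr_zero)
  moreover have "\<Union>\<F> \<in> null_sets M"
  proof (rule null_sets_UN'[where N = id, simplified, OF \<F>(2)])
    fix U assume "U \<in> \<F>"
    then show "U \<in> null_sets M"
      using \<F>(1) assms by (auto simp: null_sets_def)
  qed
  ultimately show ?thesis
    by (rule AE_I'[rotated])
qed

lemma compactly_supported_distributionD:
  assumes "compactly_supported_distribution M"
  shows "prob_space M" "sets M = sets borel" "supp_inf M \<in> measure_support M"
    "AE x in M. supp_inf M \<le> x" "\<exists>K. AE x in M. \<bar>x\<bar> \<le> K"
proof -
  interpret M: real_distribution M
    using assms by (simp add: compactly_supported_distribution_def)
  show "prob_space M" "sets M = sets borel"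
    by (auto intro: M.prob_space_axioms)
  have cpt: "compact (measure_support M)"
    using assms by (simp add: compactly_supported_distribution_def)
  have AE: "AE x in M. x \<in> measure_support M"
    by (rule AE_measure_support) simp
  have "measure_support M \<noteq> {}"
    using AE M.AE_False by auto
  then show "supp_inf M \<in> measure_support M"
    unfolding supp_inf_def using cpt
    by (intro closed_contains_Inf) (auto intro: bounded_imp_bdd_below compact_imp_bounded compact_imp_closed)
  show "AE x in M. supp_inf M \<le> x"
    using AE unfolding supp_inf_def
    by eventually_elim (auto intro!: cInf_lower bounded_imp_bdd_below compact_imp_bounded cpt)
  from cpt obtain K where K: "\<forall>x\<in>measure_support M. \<bar>x\<bar> \<le> K"
    by (metis compact_imp_bounded bounded_iff real_norm_def)
  then show "\<exists>K. AE x in M. \<bar>x\<bar> \<le> K"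
  proof (intro exI)
    show "AE x in M. \<bar>x\<bar> \<le> K"
      using AE by eventually_elim (use K in auto)
  qed
qed

section \<open>Expansions and analyticity of the transform\<close>

text \<open>The geometric series is integrated term by term. It is used with \<open>h = 1\<close>
  and \<open>f x = x\<close> for the moments, and with \<open>h x = f x = 1 / (x - z)\<close> for
  the Taylor series of the transform.\<close>

lemma has_fps_expansion_integral:
  fixes f h :: "'a \<Rightarrow> complex"
  assumes "finite_measure M" and [measurable]: "f \<in> borel_measurable M" "h \<in> borel_measurable M"
    and f: "AE x in M. norm (f x) \<le> K" and h: "AE x in M. norm (h x) \<le> B"
  shows "(\<lambda>u. \<integral>x. h x / (1 - u * f x) \<partial>M) has_fps_expansion Abs_fps (\<lambda>n. \<integral>x. h x * f x ^ n \<partial>M)"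
proof (rule has_fps_expansionI)
  interpret finite_measure M by fact
  define k where "k = max K 0"
  define b where "b = max B 0"
  have f': "AE x in M. norm (f x) \<le> k"
    using f by eventually_elim (simp add: k_def)
  have h': "AE x in M. norm (h x) \<le> b"
    using h by eventually_elim (simp add: b_def)
  \<comment> \<open>The radius \<open>1 / (k + 1)\<close> also covers \<open>k = 0\<close> and keeps
    the ratio \<open>q\<close> below 1.\<close>
  have "eventually (\<lambda>u :: complex. norm u < 1 / (k + 1)) (nhds 0)"
    by (rule eventually_nhds_metric[THEN iffD2]) (auto intro!: exI[of _ "1 / (k + 1)"] simp: k_def)
  then show "\<forall>\<^sub>F u in nhds 0. (\<lambda>n. Abs_fps (\<lambda>n. \<integral>x. h x * f x ^ n \<partial>M) $ n * u ^ n) sums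
      (\<integral>x. h x / (1 - u * f x) \<partial>M)"
  proof eventually_elim
    case (elim u)
    define q where "q = norm u * k"
    have "norm u * (k + 1) < 1"
      using elim by (simp add: k_def pos_less_divide_eq)
    then have q: "0 \<le> q" "q < 1"
      using norm_ge_zero[of u] by (auto simp: q_def k_def distrib_left simp del: norm_ge_zero)
    have bound: "AE x in M. norm (h x * (u * f x) ^ n) \<le> b * q ^ n" for n
      using f' h'
    proof eventually_elim
      case (elim x)
      then have "norm u * norm (f x) \<le> q"
        by (simp add: q_def mult_left_mono)
      then show ?case
        unfolding norm_mult norm_power using elim
        by (intro mult_mono power_mono) (auto simp: b_def)
    qed
    have int: "integrable M (\<lambda>x. h x * (u * f x) ^ n)" for n
      by (rule integrable_const_bound[OF bound]) measurable
    have "(\<lambda>n. \<integral>x. h x * (u * f x) ^ n \<partial>M) sums (\<integral>x. suminf (\<lambda>n. h x * (u * f x) ^ n) \<partial>M)"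
    proof (rule sums_integral[OF int])
      have "AE x in M. \<forall>n. norm (h x * (u * f x) ^ n) \<le> b * q ^ n"
        using bound by (simp add: AE_all_countable)
      then show "AE x in M. summable (\<lambda>n. norm (h x * (u * f x) ^ n))"
      proof eventually_elim
        case (elim x)
        show ?case
          by (rule summable_comparison_test'[of "\<lambda>n. b * q ^ n" 0])
            (use q elim in \<open>auto intro!: summable_mult summable_geometric\<close>)
      qed
      show "summable (\<lambda>n. \<integral>x. norm (h x * (u * f x) ^ n) \<partial>M)"
      proof (rule summable_comparison_test'[of "\<lambda>n. b * measure M (space M) * q ^ n" 0])
        show "summable (\<lambda>n. b * measure M (space M) * q ^ n)"
          by (intro summable_mult summable_geometric) (use q in auto)
        fix n
        have "(\<integral>x. norm (h x * (u * f x) ^ n) \<partial>M) \<le> (\<integral>x. b * q ^ n \<partial>M)"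
          by (rule integral_mono_AE[OF integrable_norm[OF int] _ bound]) simp
        then show "norm (\<integral>x. norm (h x * (u * f x) ^ n) \<partial>M) \<le> b * measure M (space M) * q ^ n"
          by (simp add: mult_ac)
      qed
    qed
    also have "(\<integral>x. suminf (\<lambda>n. h x * (u * f x) ^ n) \<partial>M) = (\<integral>x. h x / (1 - u * f x) \<partial>M)"
    proof (rule integral_cong_AE)
      show "AE x in M. suminf (\<lambda>n. h x * (u * f x) ^ n) = h x / (1 - u * f x)"
        using f'
      proof eventually_elim
        case (elim x)
        then have "norm (u * f x) \<le> q"
          by (simp add: q_def norm_mult mult_left_mono)
        then have "norm (u * f x) < 1"
          using q by simp
        then show ?case
          by (subst suminf_mult) (auto simp: suminf_geometric summable_geometric)
      qed
    qed measurable
    finally show ?case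
      by (simp add: power_mult_distrib mult_ac flip: integral_mult_right_zero)
  qed
qed

definition cstieltjes :: "real measure \<Rightarrow> complex \<Rightarrow> complex" where
  "cstieltjes M z = (\<integral>x. 1 / (complex_of_real x - z) \<partial>M)"

lemma cstieltjes_of_real: "cstieltjes M (of_real z) = of_real (stieltjes M z)"
proof -
  have "(\<lambda>x. 1 / (complex_of_real x - of_real z)) = (\<lambda>x. of_real (1 / (x - z)))"
    by simp
  then show ?thesis
    unfolding cstieltjes_def stieltjes_def by (simp only: integral_complex_of_real)
qed

lemma moment_fps_has_fps_expansion:
  assumes "compactly_supported_distribution M"
  shows "(\<lambda>u. \<integral>x. 1 / (1 - u * complex_of_real x) \<partial>M) has_fps_expansion moment_fps M"
proof -
  interpret prob_space M by (rule compactly_supported_distributionD(1)[OF assms])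
  note [measurable_cong] = compactly_supported_distributionD(2)[OF assms]
  obtain K where K: "AE x in M. \<bar>x\<bar> \<le> K"
    using compactly_supported_distributionD(5)[OF assms] by blast
  have "(\<lambda>u. \<integral>x. 1 / (1 - u * complex_of_real x) \<partial>M) has_fps_expansion
      Abs_fps (\<lambda>n. \<integral>x. 1 * complex_of_real x ^ n \<partial>M)"
    by (rule has_fps_expansion_integral[OF finite_measure_axioms, where K = K and B = 1]) (use K in auto)
  then show ?thesis
    by (simp add: moment_fps_def flip: of_real_power)
qed

lemma AE_norm_kernel_le:
  assumes M: "compactly_supported_distribution M" and z: "Re z < supp_inf M"
  shows "AE x in M. norm (1 / (complex_of_real x - z)) \<le> 1 / (supp_inf M - Re z)"
  using compactly_supported_distributionD(4)[OF M]
proof eventually_elim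
  case (elim x)
  have "supp_inf M - Re z \<le> Re (complex_of_real x - z)"
    using elim by simp
  also have "\<dots> \<le> norm (complex_of_real x - z)"
    by (rule complex_Re_le_cmod)
  finally show ?case
    using z by (simp add: norm_divide frac_le)
qed

text \<open>With \<open>y = 1 / (x - z)\<close> the kernel at \<open>z + u\<close> is
  \<open>y / (1 - u y)\<close>.\<close>

lemma cstieltjes_has_fps_expansion:
  assumes "compactly_supported_distribution M" "Re z < supp_inf M"
  shows "(\<lambda>u. cstieltjes M (z + u)) has_fps_expansion
    Abs_fps (\<lambda>n. \<integral>x. (1 / (complex_of_real x - z)) ^ Suc n \<partial>M)"
proof -
  interpret prob_space M by (rule compactly_supported_distributionD(1)[OF assms(1)])
  note [measurable_cong] = compactly_supported_distributionD(2)[OF assms(1)]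
  have AE: "AE x in M. supp_inf M \<le> x"
    by (rule compactly_supported_distributionD(4)[OF assms(1)])
  let ?y = "\<lambda>x. 1 / (complex_of_real x - z)"
  note bound = AE_norm_kernel_le[OF assms]
  have "(\<lambda>u. \<integral>x. ?y x / (1 - u * ?y x) \<partial>M) has_fps_expansion
      Abs_fps (\<lambda>n. \<integral>x. ?y x * ?y x ^ n \<partial>M)"
    by (rule has_fps_expansion_integral[OF finite_measure_axioms _ _ bound bound]) measurable
  moreover have "(\<lambda>u. \<integral>x. ?y x / (1 - u * ?y x) \<partial>M) = (\<lambda>u. cstieltjes M (z + u))"
  proof
    fix u
    show "(\<integral>x. ?y x / (1 - u * ?y x) \<partial>M) = cstieltjes M (z + u)"
      unfolding cstieltjes_def
    proof (rule integral_cong_AE)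
      show "AE x in M. ?y x / (1 - u * ?y x) = 1 / (complex_of_real x - (z + u))"
        using AE
      proof eventually_elim
        case (elim x)
        then have "complex_of_real x - z \<noteq> 0"
          using assms(2) by (auto simp: complex_eq_iff)
        then show ?case
          \<comment> \<open>If \<open>x - z = u\<close>, both sides are divisions by zero and equal
            0.\<close>
          by (cases "complex_of_real x - z = u") (auto simp: divide_simps algebra_simps)
      qed
    qed measurable
  qed
  ultimately show ?thesis
    by simp
qed

lemma cstieltjes_holomorphic:
  assumes "compactly_supported_distribution M"
  shows "cstieltjes M holomorphic_on {z. Re z < supp_inf M}"
proof -
  have "cstieltjes M analytic_on {z. Re z < supp_inf M}"
    by (subst analytic_on_analytic_at)
      (auto intro: has_fps_expansion_imp_analytic cstieltjes_has_fps_expansion assms)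
  then show ?thesis
    by (rule analytic_imp_holomorphic)
qed

text \<open>The kernel has positive real part. This keeps the transform in the right half-plane,
  where the R-transform is composed with it.\<close>

lemma cstieltjes_Re_pos:
  assumes "compactly_supported_distribution M" "Re z < supp_inf M"
  shows "0 < Re (cstieltjes M z)"
proof -
  interpret prob_space M by (rule compactly_supported_distributionD(1)[OF assms(1)])
  note [measurable_cong] = compactly_supported_distributionD(2)[OF assms(1)]
  have AE: "AE x in M. supp_inf M \<le> x"
    by (rule compactly_supported_distributionD(4)[OF assms(1)])
  have int: "integrable M (\<lambda>x. 1 / (complex_of_real x - z))"
    by (rule integrable_const_bound[OF AE_norm_kernel_le[OF assms]]) measurable
  have "0 < (\<integral>x. Re (1 / (complex_of_real x - z)) \<partial>M)"
  proof (rule integral_less_AE_space[where X = "\<lambda>_. 0", simplified])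
    show "integrable M (\<lambda>x. Re (1 / (complex_of_real x - z)))"
      by (rule integrable_Re[OF int])
    show "AE x in M. 0 < Re (1 / (complex_of_real x - z))"
      using AE
    proof eventually_elim
      case (elim x)
      then have "complex_of_real x - z \<noteq> 0"
        using assms(2) by (auto simp: complex_eq_iff)
      then show ?case
        using elim assms(2) by (simp add: Re_divide' cmod_power2 power2_eq_square add_nonneg_pos)
    qed
    show "emeasure M (space M) \<noteq> 0"
      by (simp add: emeasure_space_1)
  qed
  then show ?thesis
    unfolding cstieltjes_def using integral_Re[OF int] by simp
qed

text \<open>Pringsheim: the Taylor coefficients of the transform at \<open>z\<^sub>0 < supp_inf M\<close> are nonnegative, so
  the edge of the support is a singularity.\<close>

lemma no_continuation_at_edge:
  assumes M: "compactly_supported_distribution M" and "r > 0"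
    and L: "L holomorphic_on ball (of_real (supp_inf M)) r"
    and eq: "\<And>y. supp_inf M - r < y \<Longrightarrow> y < supp_inf M \<Longrightarrow> L (of_real y) = of_real (stieltjes M y)"
  shows False
proof -
  interpret prob_space M by (rule compactly_supported_distributionD(1)[OF M])
  have sets[measurable_cong]: "sets M = sets borel"
    by (rule compactly_supported_distributionD(2)[OF M])
  have AE: "AE x in M. supp_inf M \<le> x"
    by (rule compactly_supported_distributionD(4)[OF M])
  define e where "e = supp_inf M"
  \<comment> \<open>The disc of radius \<open>2 d\<close> about \<open>e - d\<close> lies in the
    given ball of radius \<open>r = 3 d\<close> and reaches past the edge \<open>e\<close>.\<close>
  define d where "d = r / 3"
  have d: "d > 0" using \<open>r > 0\<close> by (simp add: d_def)
  define z0 where "z0 = e - d"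
  have sub: "ball (complex_of_real z0) (2 * d) \<subseteq> ball (of_real e) r"
  proof
    fix z assume "z \<in> ball (complex_of_real z0) (2 * d)"
    moreover have "dist (complex_of_real e) z \<le> dist (complex_of_real e) (of_real z0) + dist (complex_of_real z0) z"
      by (rule dist_triangle)
    ultimately show "z \<in> ball (of_real e) r"
      using d by (simp add: z0_def d_def dist_norm flip: of_real_diff)
  qed
  have sub2: "ball (complex_of_real z0) d \<subseteq> {z. Re z < e}"
  proof
    fix z assume "z \<in> ball (complex_of_real z0) d"
    then have "\<bar>Re (z - of_real z0)\<bar> < d"
      using abs_Re_le_cmod[of "z - of_real z0"] by (simp add: dist_norm norm_minus_commute)
    then show "z \<in> {z. Re z < e}"
      by (simp add: z0_def)
  qed
  \<comment> \<open>The identity theorem, from the real segment to the whole disc of radius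
    \<open>d\<close>.\<close>
  have agree: "L z - cstieltjes M z = 0" if "z \<in> ball (of_real z0) d" for z
  proof (rule analytic_continuation[where f = "\<lambda>z. L z - cstieltjes M z" and w = z
        and S = "ball (of_real z0) d" and U = "of_real ` {z0 - d<..<z0 + d}"
        and \<xi> = "of_real z0"])
    show "(\<lambda>z. L z - cstieltjes M z) holomorphic_on ball (of_real z0) d"
    proof (rule holomorphic_on_diff)
      have "ball (complex_of_real z0) d \<subseteq> ball (of_real z0) (2 * d)"
        using d by (intro subset_ball) simp
      with sub show "L holomorphic_on ball (of_real z0) d"
        by (intro holomorphic_on_subset[OF L]) (simp add: e_def)
      show "cstieltjes M holomorphic_on ball (of_real z0) d"
        using sub2 by (intro holomorphic_on_subset[OF cstieltjes_holomorphic[OF M]]) (simp add: e_def)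
    qed
    show "of_real ` {z0 - d<..<z0 + d} \<subseteq> ball (complex_of_real z0) d"
      by (auto simp: dist_norm simp flip: of_real_diff)
    show "complex_of_real z0 islimpt of_real ` {z0 - d<..<z0 + d}"
      unfolding islimpt_approachable
    proof (intro allI impI)
      fix \<epsilon> :: real assume "\<epsilon> > 0"
      then show "\<exists>w\<in>of_real ` {z0 - d<..<z0 + d}. w \<noteq> complex_of_real z0 \<and> dist w (of_real z0) < \<epsilon>"
        using d by (intro bexI[of _ "of_real (z0 + min \<epsilon> d / 2)"] imageI)
          (auto simp: dist_norm min_def simp del: of_real_add simp flip: of_real_diff)
    qed
    show "L z - cstieltjes M z = 0" if "z \<in> of_real ` {z0 - d<..<z0 + d}" for z
      using that eq d by (auto simp: cstieltjes_of_real e_def z0_def d_def)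
  qed (use d that in auto)
  define c where "c n = (\<integral>x. (1 / (x - z0)) ^ Suc n \<partial>M)" for n
  have c: "(\<integral>x. (1 / (complex_of_real x - of_real z0)) ^ Suc n \<partial>M) = of_real (c n)" for n
  proof -
    have "(\<lambda>x. (1 / (complex_of_real x - of_real z0)) ^ Suc n) = (\<lambda>x. of_real ((1 / (x - z0)) ^ Suc n))"
      by simp
    then show ?thesis
      by (simp only: integral_complex_of_real c_def)
  qed
  have "(\<lambda>u. cstieltjes M (of_real z0 + u)) has_fps_expansion
      Abs_fps (\<lambda>n. \<integral>x. (1 / (complex_of_real x - of_real z0)) ^ Suc n \<partial>M)"
    by (rule cstieltjes_has_fps_expansion[OF M]) (use d in \<open>simp add: z0_def e_def\<close>)
  then have G: "(\<lambda>u. cstieltjes M (of_real z0 + u)) has_fps_expansion Abs_fps (\<lambda>n. of_real (c n))"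
    unfolding c .
  have "\<forall>\<^sub>F u in nhds 0. cstieltjes M (of_real z0 + u) = L (of_real z0 + u)"
    using d agree by (auto simp: eventually_nhds_metric dist_norm intro!: exI[of _ d])
  from has_fps_expansion_cong[OF this refl] G
  have "(\<lambda>u. L (of_real z0 + u)) has_fps_expansion Abs_fps (\<lambda>n. of_real (c n))"
    by simp
  \<comment> \<open>As \<open>L\<close> is holomorphic in the larger disc, the Taylor series
    converges at \<open>e + d / 2\<close>, beyond the edge.\<close>
  then have "(\<lambda>n. Abs_fps (\<lambda>n. complex_of_real (c n)) $ n * of_real (3 / 2 * d) ^ n) sums L (of_real z0 + of_real (3 / 2 * d))"
  proof (rule has_fps_expansion_imp_sums_complex[where r = "ereal (2 * d)"])
    have "L \<circ> (\<lambda>u. of_real z0 + u) holomorphic_on ball 0 (2 * d)"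
    proof (rule holomorphic_on_compose_gen[OF _ L])
      show "(\<lambda>u. complex_of_real z0 + u) ` ball 0 (2 * d) \<subseteq> ball (of_real (supp_inf M)) r"
      proof clarify
        fix u :: complex assume "u \<in> ball 0 (2 * d)"
        then have "of_real z0 + u \<in> ball (of_real z0) (2 * d)"
          by (simp add: dist_norm)
        then show "of_real z0 + u \<in> ball (of_real (supp_inf M)) r"
          using sub unfolding e_def by blast
      qed
    qed (intro holomorphic_intros)
    then have "(\<lambda>u. L (of_real z0 + u)) holomorphic_on ball 0 (2 * d)"
      by (simp add: o_def)
    then show "(\<lambda>u. L (of_real z0 + u)) holomorphic_on eball 0 (ereal (2 * d))"
      by (simp add: eball_ereal)
  qed (use d in auto)
  from summable_LIMSEQ_zero[OF sums_summable[OF this]]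
  have "(\<lambda>n. complex_of_real (c n * (3 / 2 * d) ^ n)) \<longlonglongrightarrow> 0"
    by simp
  then have lim: "(\<lambda>n. c n * (3 / 2 * d) ^ n) \<longlonglongrightarrow> 0"
    using tendsto_of_real_iff[of "\<lambda>n. c n * (3 / 2 * d) ^ n" 0, where ?'a = complex] by simp
  \<comment> \<open>The edge lies in the support, so \<open>U\<close> has positive mass. On it
    \<open>x - z0\<close> is at most \<open>5 / 4 * d\<close>, and the terms of the series grow at
    least like \<open>(6 / 5) ^ n\<close>.\<close>
  define U where "U = {e - d / 4<..<e + d / 4}"
  define m where "m = measure M U"
  have m: "m > 0"
  proof -
    have "emeasure M U > 0"
      using compactly_supported_distributionD(3)[OF M] d
      unfolding measure_support_def U_def e_def by auto
    then show ?thesis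
      by (simp add: m_def emeasure_eq_measure)
  qed
  have "m / (5 / 4 * d) \<le> c n * (3 / 2 * d) ^ n" for n
  proof -
    have bound: "AE x in M. norm ((1 / (x - z0)) ^ Suc n) \<le> (1 / d) ^ Suc n"
      using AE
    proof eventually_elim
      case (elim x)
      then have "x - z0 \<ge> d"
        by (simp add: z0_def e_def)
      then show ?case
        using d unfolding norm_power by (intro power_mono) (auto simp: frac_le)
    qed
    have int: "integrable M (\<lambda>x. (1 / (x - z0)) ^ Suc n)"
      by (rule integrable_const_bound[OF bound]) measurable
    have "AE x in M. indicator U x * (1 / (5 / 4 * d)) ^ Suc n \<le> (1 / (x - z0)) ^ Suc n"
      using AE
    proof eventually_elim
      case (elim x)
      then have x: "x - z0 \<ge> d"
        by (simp add: z0_def e_def)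
      show ?case
      proof (cases "x \<in> U")
        case True
        then have "x - z0 \<le> 5 / 4 * d"
          by (simp add: U_def z0_def)
        then have "(1 / (5 / 4 * d)) ^ Suc n \<le> (1 / (x - z0)) ^ Suc n"
          using d x by (intro power_mono divide_left_mono) auto
        then show ?thesis using True by simp
      next
        case False
        then show ?thesis using x d by simp
      qed
    qed
    then have "(\<integral>x. indicator U x * (1 / (5 / 4 * d)) ^ Suc n \<partial>M) \<le> c n"
      unfolding c_def by (intro integral_mono_AE int integrable_mult_left integrable_real_indicator)
        (auto simp: U_def sets emeasure_eq_measure)
    then have "m * (1 / (5 / 4 * d)) ^ Suc n \<le> c n"
      by (simp add: m_def U_def sets)
    then have "m * (1 / (5 / 4 * d)) ^ Suc n * (3 / 2 * d) ^ n \<le> c n * (3 / 2 * d) ^ n"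
      using d by (intro mult_right_mono) auto
    also have "m * (1 / (5 / 4 * d)) ^ Suc n * (3 / 2 * d) ^ n = m / (5 / 4 * d) * (6 / 5) ^ n"
    proof -
      have "m * (1 / (5 / 4 * d)) ^ Suc n * (3 / 2 * d) ^ n
          = m * (1 / (5 / 4 * d)) * (1 / (5 / 4 * d) * (3 / 2 * d)) ^ n"
        by (simp only: power_mult_distrib power_Suc mult_ac)
      also have "1 / (5 / 4 * d) * (3 / 2 * d) = 6 / 5"
        using d by (simp add: field_simps)
      finally show ?thesis by simp
    qed
    finally have "m / (5 / 4 * d) * (6 / 5) ^ n \<le> c n * (3 / 2 * d) ^ n" .
    moreover have "m / (5 / 4 * d) * 1 \<le> m / (5 / 4 * d) * (6 / 5) ^ n"
      using m d by (intro mult_left_mono) (auto intro: one_le_power)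
    ultimately show ?thesis by simp
  qed
  then have "m / (5 / 4 * d) \<le> 0"
    by (intro LIMSEQ_le_const[OF lim]) auto
  then show False
    using m d by (simp add: field_simps)
qed

text \<open>\<open>\<Phi>\<close> is locally invertible at \<open>t\<close>, and \<open>K\<close>
  after its inverse would continue the transform past the edge. This serves twice, with
  \<open>H\<close> and with \<open>F\<close> as the real map \<open>\<phi>\<close>.\<close>

lemma no_continuation_via_chart:
  fixes \<phi> :: "real \<Rightarrow> real" and \<Phi> K :: "complex \<Rightarrow> complex"
  assumes M: "compactly_supported_distribution M" and "open U" "complex_of_real t \<in> U"
    and \<Phi>: "\<Phi> holomorphic_on U" "deriv \<Phi> (of_real t) \<noteq> 0" and K: "K holomorphic_on U"
    and s: "s < t" and real: "\<And>x. s < x \<Longrightarrow> x \<le> t \<Longrightarrow> \<Phi> (of_real x) = of_real (\<phi> x)"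
    and t: "\<phi> t = supp_inf M" and below: "\<And>x. s < x \<Longrightarrow> x < t \<Longrightarrow> \<phi> x < supp_inf M"
    and eq: "\<And>x. s < x \<Longrightarrow> x < t \<Longrightarrow> K (of_real x) = of_real (stieltjes M (\<phi> x))"
  shows False
proof -
  obtain \<epsilon> where \<epsilon>: "\<epsilon> > 0" "ball (of_real t) \<epsilon> \<subseteq> U" "open (\<Phi> ` ball (of_real t) \<epsilon>)"
      "inj_on \<Phi> (ball (of_real t) \<epsilon>)"
    using has_complex_derivative_locally_invertible[OF \<Phi>(1) assms(3,2) \<Phi>(2)] by blast
  let ?B = "ball (complex_of_real t) \<epsilon>"
  obtain \<Psi> where \<Psi>: "\<Psi> holomorphic_on \<Phi> ` ?B" "\<And>z. z \<in> ?B \<Longrightarrow> \<Psi> (\<Phi> z) = z"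
    using holomorphic_has_inverse[OF holomorphic_on_subset[OF \<Phi>(1) \<epsilon>(2)] _ \<epsilon>(4)] by blast
  have "of_real (supp_inf M) \<in> \<Phi> ` ?B"
    using \<epsilon>(1) real[of t] s t by (intro image_eqI[of _ _ "of_real t"]) auto
  then obtain r where r: "r > 0" "ball (of_real (supp_inf M)) r \<subseteq> \<Phi> ` ?B"
    using \<epsilon>(3) by (meson openE)
  define x0 where "x0 = max ((s + t) / 2) (t - \<epsilon> / 2)"
  have x0: "s < x0" "x0 < t" "t - \<epsilon> < x0"
    using s \<epsilon>(1) by (auto simp: x0_def max_def)
  have inB: "complex_of_real x \<in> ?B" if "x0 \<le> x" "x \<le> t" for x
    using that x0 by (simp add: dist_norm flip: of_real_diff)
  have cont: "continuous_on {x0..t} \<phi>"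
  proof -
    have "continuous_on (of_real ` {x0..t}) \<Phi>"
      using \<epsilon>(2) inB by (intro continuous_on_subset[OF holomorphic_on_imp_continuous_on[OF \<Phi>(1)]]) auto
    then have "continuous_on {x0..t} (\<Phi> \<circ> complex_of_real)"
      by (rule continuous_on_compose[rotated]) (intro continuous_intros)
    then have "continuous_on {x0..t} (\<lambda>x. Re ((\<Phi> \<circ> complex_of_real) x))"
      by (rule continuous_on_Re)
    then show ?thesis
      by (rule continuous_on_eq) (use real x0 in auto)
  qed
  \<comment> \<open>With this radius the intermediate value theorem on \<open>{x0..t}\<close>
    reaches all real \<open>y\<close> of the ball below the edge.\<close>
  define r' where "r' = min r (supp_inf M - \<phi> x0)"
  have r': "r' > 0" "r' \<le> r" "r' \<le> supp_inf M - \<phi> x0"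
    using r(1) below[OF x0(1,2)] by (auto simp: r'_def)
  show False
  proof (rule no_continuation_at_edge[where L = "K \<circ> \<Psi>", OF M r'(1)])
    show "(K \<circ> \<Psi>) holomorphic_on ball (of_real (supp_inf M)) r'"
    proof (rule holomorphic_on_compose_gen[OF _ K])
      show "\<Psi> holomorphic_on ball (of_real (supp_inf M)) r'"
        using r r' by (intro holomorphic_on_subset[OF \<Psi>(1)]) auto
      show "\<Psi> ` ball (of_real (supp_inf M)) r' \<subseteq> U"
      proof clarify
        fix w :: complex assume "w \<in> ball (of_real (supp_inf M)) r'"
        then have "w \<in> ball (of_real (supp_inf M)) r"
          using r'(2) by simp
        then obtain z where "z \<in> ?B" "w = \<Phi> z"
          using r(2) by blast
        then show "\<Psi> w \<in> U"
          using \<Psi>(2)[of z] \<epsilon>(2) by auto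
      qed
    qed
    fix y assume y: "supp_inf M - r' < y" "y < supp_inf M"
    then have "\<phi> x0 \<le> y" "y \<le> \<phi> t" "x0 \<le> t"
      using r' x0 t by auto
    from IVT'[OF this cont] obtain x where x: "x0 \<le> x" "x \<le> t" "\<phi> x = y"
      by blast
    have "x \<noteq> t"
      using x y t by auto
    then have "K (of_real x) = of_real (stieltjes M y)"
      using x x0 eq[of x] by simp
    moreover have "\<Psi> (of_real y) = of_real x"
      using \<Psi>(2)[OF inB[OF x(1,2)]] real[of x] x x0 by simp
    ultimately show "(K \<circ> \<Psi>) (of_real y) = of_real (stieltjes M y)"
      by simp
  qed
qed

section \<open>Subordination near minus infinity\<close>

text \<open>The functional equation with \<open>w = fps_X\<close>, so that \<open>g\<close> is the
  Cauchy transform of \<open>\<nu>\<close>. The hypothesis says that \<open>r\<close> is the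
  R-transform of \<open>\<mu>\<close> at \<open>g\<close>; then \<open>1 / v = 1 / g + r\<close> and
  \<open>1 / t = 1 / fps_X + r\<close>.\<close>

lemma moment_fps_subordination:
  assumes conv: "is_free_convolution \<mu> \<nu> \<rho>"
    and \<mu>: "\<And>v. v $ 0 = 0 \<Longrightarrow> v * (1 + fps_X * moment_fps \<nu> * r) = fps_X * moment_fps \<nu>
      \<Longrightarrow> moment_fps \<mu> oo v = 1 + fps_X * moment_fps \<nu> * r"
  shows "moment_fps \<rho> oo (fps_X * inverse (1 + fps_X * r)) = moment_fps \<nu> * (1 + fps_X * r)"
proof -
  obtain \<phi> where \<phi>: "unital_functional \<phi>" "free_variables \<phi>"
    and laws: "has_law \<phi> (nc_var VarX) \<mu>" "has_law \<phi> (nc_var VarY) \<nu>"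
      "has_law \<phi> (nc_var VarX + nc_var VarY) \<rho>"
    using conv by (auto simp: is_free_convolution_def)
  define g where "g = fps_X * moment_fps \<nu>"
  have inverse: "f * inverse (1 + fps_X * q) * (1 + fps_X * q) = f" for f q :: "complex fps"
    by (simp add: mult.assoc inverse_mult_eq_1)
  define v where "v = g * inverse (1 + fps_X * (moment_fps \<nu> * r))"
  have v: "v $ 0 = 0" "v * (1 + g * r) = g"
    using inverse[of g "moment_fps \<nu> * r"] by (simp_all add: v_def g_def mult.assoc)
  have m1: "moment_fps \<mu> oo v = 1 + g * r"
    using \<mu>[of v] v by (simp add: g_def)
  define t where "t = fps_X * inverse (1 + fps_X * r)"
  have t: "t * (1 + fps_X * r) = fps_X"
    unfolding t_def by (rule inverse)
  have sum: "1 + g * r + moment_fps \<nu> - 1 = (1 + fps_X * r) * moment_fps \<nu>"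
    by (simp add: g_def algebra_simps)
  have "t * (1 + g * r + moment_fps \<nu> - 1) = g"
    unfolding sum unfolding mult.assoc[symmetric] t g_def ..
  then have "moment_fps \<rho> oo t = (moment_fps \<mu> oo v) + (moment_fps \<nu> oo fps_X) - 1"
    by (intro moment_fps_free_convolution[OF \<phi> laws, where g = g]) (use v in \<open>simp_all add: m1 g_def t_def\<close>)
  then have "moment_fps \<rho> oo t = 1 + g * r + moment_fps \<nu> - 1"
    by (simp add: m1)
  then show ?thesis
    unfolding sum t_def by (simp add: mult.commute)
qed

text \<open>The total mass is read off from the unital functional instead of integrating a
  density.\<close>

lemma moment_fps_nth_0:
  assumes "is_free_convolution \<mu> \<nu> \<rho>"
  shows "moment_fps \<mu> $ 0 = 1"
proof -
  obtain \<phi> where "unital_functional \<phi>" "has_law \<phi> (nc_var VarX) \<mu>"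
    using assms by (auto simp: is_free_convolution_def)
  then have "\<phi> (nc_var VarX ^ 0) = of_real (\<integral>x. x ^ 0 \<partial>\<mu>)" "\<phi> 1 = 1"
    by (auto simp: has_law_def unital_functional_def simp del: power_0)
  then show ?thesis
    by (simp add: moment_fps_def)
qed

lemma integral_geometric_kernel:
  assumes "h \<noteq> 0"
  shows "(\<integral>x. 1 / (1 - complex_of_real (1 / h) * complex_of_real x) \<partial>M) = - of_real (h * stieltjes M h)"
proof -
  have "(\<lambda>x. 1 / (1 - complex_of_real (1 / h) * complex_of_real x)) = (\<lambda>x. of_real (- h * (1 / (x - h))))"
  proof
    fix x
    have "1 / (1 - 1 / h * x) = - h * (1 / (x - h))"
      using assms by (cases "x = h") (auto simp: field_simps)
    then have "complex_of_real (1 / (1 - 1 / h * x)) = of_real (- h * (1 / (x - h)))"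
      by simp
    then show "1 / (1 - complex_of_real (1 / h) * complex_of_real x) = of_real (- h * (1 / (x - h)))"
      by simp
  qed
  then show ?thesis
    unfolding stieltjes_def by (simp only: integral_complex_of_real integral_mult_right_zero) simp
qed

text \<open>Both sides of the formal identity are expansions of functions, which therefore agree
  near 0; substitute \<open>u = 1 / h\<close>. Here \<open>k h\<close> is the R-transform of
  \<open>\<mu>\<close> at the Cauchy transform of \<open>\<nu>\<close> in \<open>h\<close>.\<close>

lemma stieltjes_subordination_at_bot:
  assumes conv: "is_free_convolution \<mu> \<nu> \<rho>" and \<nu>: "compactly_supported_distribution \<nu>"
    and \<mu>: "\<And>v. v $ 0 = 0 \<Longrightarrow> v * (1 + fps_X * moment_fps \<nu> * r) = fps_X * moment_fps \<nu>
      \<Longrightarrow> moment_fps \<mu> oo v = 1 + fps_X * moment_fps \<nu> * r"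
    and f: "f has_fps_expansion r"
    and k: "\<And>h. h < 0 \<Longrightarrow> f (of_real (1 / h)) = of_real (k h)"
  shows "eventually (\<lambda>h. stieltjes \<rho> (h + k h) = stieltjes \<nu> h) at_bot"
proof -
  have \<rho>: "compactly_supported_distribution \<rho>"
    using conv by (simp add: is_free_convolution_def)
  define P where "P M u = (\<integral>x. 1 / (1 - u * complex_of_real x) \<partial>M)" for M u
  define T where "T u = u * inverse (1 + u * f u)" for u
  have P: "P \<nu> has_fps_expansion moment_fps \<nu>" "P \<rho> has_fps_expansion moment_fps \<rho>"
    unfolding P_def[abs_def] by (intro moment_fps_has_fps_expansion \<nu> \<rho>)+
  have T: "T has_fps_expansion fps_X * inverse (1 + fps_X * r)"
    unfolding T_def[abs_def] by (intro fps_expansion_intros f) simp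
  have "(\<lambda>u. (P \<rho> \<circ> T) u - P \<nu> u * (1 + u * f u)) has_fps_expansion
      (moment_fps \<rho> oo (fps_X * inverse (1 + fps_X * r))) - moment_fps \<nu> * (1 + fps_X * r)"
    by (intro has_fps_expansion_diff has_fps_expansion_compose P T has_fps_expansion_mult
        has_fps_expansion_add has_fps_expansion_1 has_fps_expansion_fps_X f) simp
  then have "(\<lambda>u. (P \<rho> \<circ> T) u - P \<nu> u * (1 + u * f u)) has_fps_expansion 0"
    using moment_fps_subordination[OF conv \<mu>] by simp
  then have ev: "eventually (\<lambda>u. P \<rho> (T u) = P \<nu> u * (1 + u * f u)) (nhds 0)"
    by (simp add: has_fps_expansion_0_iff)
  have "(\<lambda>u. 1 + u * f u) has_fps_expansion 1 + fps_X * r"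
    by (intro fps_expansion_intros f)
  then have "continuous (at 0) (\<lambda>u. 1 + u * f u)"
    using has_fps_expansion_imp_continuous[of "\<lambda>u. 1 + u * f u" _ UNIV] by simp
  then have "((\<lambda>u. 1 + u * f u) \<longlongrightarrow> 1) (nhds 0)"
    using tendsto_at_iff_tendsto_nhds[of "\<lambda>u. 1 + u * f u" 0] by (simp add: continuous_at)
  \<comment> \<open>This keeps \<open>h + k h\<close> away from 0, so that its reciprocal may be
    used below.\<close>
  then have nz: "eventually (\<lambda>u. 1 + u * f u \<noteq> 0) (nhds 0)"
    by (rule tendsto_imp_eventually_ne) simp
  have "filterlim (\<lambda>h. complex_of_real (1 / h)) (nhds 0) at_bot"
  proof -
    have "((\<lambda>h :: real. 1 / h) \<longlongrightarrow> 0) at_bot"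
      by (intro tendsto_divide_0[OF tendsto_const] filterlim_at_bot_imp_at_infinity filterlim_ident)
    then have "((\<lambda>h. complex_of_real (1 / h)) \<longlongrightarrow> of_real 0) at_bot"
      by (rule tendsto_of_real)
    then show ?thesis by simp
  qed
  then have "eventually (\<lambda>h. P \<rho> (T (of_real (1 / h))) = P \<nu> (of_real (1 / h)) * (1 + of_real (1 / h) * f (of_real (1 / h)))
      \<and> 1 + complex_of_real (1 / h) * f (of_real (1 / h)) \<noteq> 0) at_bot"
    using eventually_conj[OF ev nz] by (rule eventually_compose_filterlim[rotated])
  then show ?thesis
    using eventually_gt_at_bot[of 0]
  proof eventually_elim
    case (elim h)
    define q where "q = h + k h"
    have fac: "1 + complex_of_real (1 / h) * f (of_real (1 / h)) = of_real (q / h)"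
      using elim k[of h] by (simp add: q_def field_simps)
    have q: "q \<noteq> 0" "h \<noteq> 0"
      using elim unfolding fac by auto
    have "T (of_real (1 / h)) = of_real (1 / q)"
      unfolding T_def fac using q by (simp add: field_simps)
    then have "P \<rho> (of_real (1 / q)) = P \<nu> (of_real (1 / h)) * of_real (q / h)"
      using elim unfolding fac by simp
    then have "complex_of_real (q * stieltjes \<rho> q) = of_real (h * stieltjes \<nu> h * (q / h))"
      unfolding P_def integral_geometric_kernel[OF q(1)] integral_geometric_kernel[OF q(2)]
      by (simp only: of_real_mult minus_mult_left[symmetric] neg_equal_iff_equal)
    then have "q * stieltjes \<rho> q = h * stieltjes \<nu> h * (q / h)"
      by (simp only: of_real_eq_iff)
    then show ?case
      using q by (simp add: q_def)
  qed
qed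

text \<open>The R-transforms \<open>\<beta>\<^sup>2 g\<close> and \<open>\<beta> / (1 - g)\<close> at \<open>g = - stieltjes \<nu> h\<close>.\<close>

lemma stieltjes_semicircle_convolution:
  assumes "\<beta> > 0" and \<nu>: "compactly_supported_distribution \<nu>"
    and conv: "is_free_convolution (semicircle_law \<beta>) \<nu> \<rho>"
  shows "eventually (\<lambda>h. stieltjes \<rho> (h - \<beta>\<^sup>2 * stieltjes \<nu> h) = stieltjes \<nu> h) at_bot"
proof -
  have "moment_fps (semicircle_law \<beta>) $ 0 = 1"
    using conv by (rule moment_fps_nth_0)
  note compose = moment_fps_semicircle_compose[OF assms(1) this _ refl]
  have exp: "(\<lambda>u. of_real (\<beta>\<^sup>2) * (u * (\<integral>x. 1 / (1 - u * complex_of_real x) \<partial>\<nu>))) has_fps_expansion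
      fps_const (of_real (\<beta>\<^sup>2)) * (fps_X * moment_fps \<nu>)"
    by (intro fps_expansion_intros moment_fps_has_fps_expansion[OF \<nu>])
  have val: "of_real (\<beta>\<^sup>2) * (complex_of_real (1 / h) * (\<integral>x. 1 / (1 - complex_of_real (1 / h) * complex_of_real x) \<partial>\<nu>))
      = of_real (- \<beta>\<^sup>2 * stieltjes \<nu> h)" if "h < 0" for h
    using that by (subst integral_geometric_kernel) auto
  have "eventually (\<lambda>h. stieltjes \<rho> (h + - \<beta>\<^sup>2 * stieltjes \<nu> h) = stieltjes \<nu> h) at_bot"
    by (rule stieltjes_subordination_at_bot[where k = "\<lambda>h. - \<beta>\<^sup>2 * stieltjes \<nu> h", OF conv \<nu> _ exp])
      (rule compose, assumption+, rule val)
  then show ?thesis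
    by simp
qed

lemma stieltjes_marchenko_pastur_convolution:
  assumes "\<beta> > 0" and \<nu>: "compactly_supported_distribution \<nu>"
    and conv: "is_free_convolution (marchenko_pastur_law \<beta>) \<nu> \<rho>"
  shows "eventually (\<lambda>h. stieltjes \<rho> (h + \<beta> / (1 + stieltjes \<nu> h)) = stieltjes \<nu> h) at_bot"
proof -
  let ?g = "fps_X * moment_fps \<nu>"
  define r where "r = fps_const (complex_of_real \<beta>) * inverse (1 - ?g)"
  have M0: "moment_fps (marchenko_pastur_law \<beta>) $ 0 = 1"
    using conv by (rule moment_fps_nth_0)
  have r: "r * (1 - ?g) = fps_const (complex_of_real \<beta>)"
    by (simp add: r_def mult.assoc inverse_mult_eq_1)
  note compose = moment_fps_marchenko_pastur_compose[OF assms(1) M0 _ r]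
  have exp: "(\<lambda>u. of_real \<beta> * inverse (1 - u * (\<integral>x. 1 / (1 - u * complex_of_real x) \<partial>\<nu>))) has_fps_expansion r"
    unfolding r_def by (intro fps_expansion_intros moment_fps_has_fps_expansion[OF \<nu>]) simp
  have val: "of_real \<beta> * inverse (1 - complex_of_real (1 / h) * (\<integral>x. 1 / (1 - complex_of_real (1 / h) * complex_of_real x) \<partial>\<nu>))
      = of_real (\<beta> / (1 + stieltjes \<nu> h))" if "h < 0" for h
    using that by (subst integral_geometric_kernel) (auto simp: divide_inverse)
  show ?thesis
    by (rule stieltjes_subordination_at_bot[where k = "\<lambda>h. \<beta> / (1 + stieltjes \<nu> h)", OF conv \<nu> _ exp])
      (rule compose, assumption+, rule val)
qed

section \<open>Strict maximality of a critical point\<close>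

definition stieltjes_deriv :: "real measure \<Rightarrow> real \<Rightarrow> real" where
  "stieltjes_deriv M z = (\<integral>x. (1 / (x - z))\<^sup>2 \<partial>M)"

lemma stieltjes_pos:
  assumes "compactly_supported_distribution M" "z < supp_inf M"
  shows "0 < stieltjes M z"
  using cstieltjes_Re_pos[of M "of_real z"] assms by (simp add: cstieltjes_of_real)

text \<open>Along the real axis the imaginary part is constant. The lemma carries information on
  real derivatives over to the charts \<open>Hc\<close> and \<open>Fc\<close>.\<close>

lemma deriv_eq_of_real:
  fixes \<Phi> :: "complex \<Rightarrow> complex"
  assumes \<Phi>: "\<Phi> holomorphic_on U" "open U" "of_real t \<in> U"
    and \<phi>: "(\<phi> has_real_derivative d) (at t)"
    and eq: "a < t" "t < b" "\<And>x. a < x \<Longrightarrow> x < b \<Longrightarrow> \<Phi> (of_real x) = of_real (\<phi> x)"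
  shows "deriv \<Phi> (of_real t) = of_real d"
proof -
  have "((\<lambda>x. \<Phi> (of_real x)) has_vector_derivative deriv \<Phi> (of_real t)) (at t)"
    by (intro has_vector_derivative_real_field holomorphic_derivI[OF \<Phi>])
  then have *: "((\<lambda>x. Re (\<Phi> (of_real x))) has_real_derivative Re (deriv \<Phi> (of_real t))) (at t)"
    "((\<lambda>x. Im (\<Phi> (of_real x))) has_real_derivative Im (deriv \<Phi> (of_real t))) (at t)"
    by (intro derivative_intros; assumption)+
  have "(\<phi> has_real_derivative Re (deriv \<Phi> (of_real t))) (at t)"
    by (rule has_field_derivative_transform_within_open[OF *(1), of "{a<..<b}"]) (use eq in auto)
  then have "Re (deriv \<Phi> (of_real t)) = d"
    using \<phi> by (rule DERIV_unique)
  moreover have "((\<lambda>_. 0) has_real_derivative Im (deriv \<Phi> (of_real t))) (at t)"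
    by (rule has_field_derivative_transform_within_open[OF *(2), of "{a<..<b}"]) (use eq in auto)
  then have "Im (deriv \<Phi> (of_real t)) = 0"
    using DERIV_const by (rule DERIV_unique)
  ultimately show ?thesis
    by (simp add: complex_eq_iff)
qed

lemma open_Re_less: "open {z. Re z < e}"
  by (intro open_Collect_less continuous_intros)

text \<open>The derivative is coefficient 1 of the Taylor expansion at \<open>z\<close>.\<close>

lemma stieltjes_has_derivative:
  assumes M: "compactly_supported_distribution M" and z: "z < supp_inf M"
  shows "(stieltjes M has_real_derivative stieltjes_deriv M z) (at z)"
proof -
  let ?F = "Abs_fps (\<lambda>n. \<integral>x. (1 / (complex_of_real x - of_real z)) ^ Suc n \<partial>M)"
  have "(\<lambda>u. cstieltjes M (of_real z + u)) has_fps_expansion ?F"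
    by (rule cstieltjes_has_fps_expansion[OF M]) (use z in simp)
  then have "deriv (\<lambda>u. cstieltjes M (of_real z + u)) 0 = fps_deriv ?F $ 0"
    by (intro has_fps_expansion_imp_0_eq_fps_nth_0 has_fps_expansion_deriv)
  moreover have "deriv (cstieltjes M) (of_real z) = deriv (\<lambda>u. cstieltjes M (of_real z + u)) 0"
    by (subst deriv_shift_0) (simp add: o_def)
  moreover have "(\<lambda>x. (1 / (complex_of_real x - of_real z)) ^ 2) = (\<lambda>x. of_real ((1 / (x - z))\<^sup>2))"
    by simp
  then have "fps_deriv ?F $ 0 = of_real (stieltjes_deriv M z)"
    unfolding stieltjes_deriv_def by (simp only: fps_deriv_nth fps_nth_Abs_fps integral_complex_of_real
        Suc_eq_plus1 add_0 numeral_2_eq_2[symmetric] of_nat_1 mult_1_left one_add_one)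
  ultimately have D: "deriv (cstieltjes M) (of_real z) = of_real (stieltjes_deriv M z)"
    by simp
  have "((\<lambda>x. cstieltjes M (of_real x)) has_vector_derivative deriv (cstieltjes M) (of_real z)) (at z)"
    by (intro has_vector_derivative_real_field holomorphic_derivI[OF cstieltjes_holomorphic[OF M] open_Re_less])
      (use z in simp)
  then have "((\<lambda>x. Re (cstieltjes M (of_real x))) has_real_derivative Re (deriv (cstieltjes M) (of_real z))) (at z)"
    by (rule derivative_intros)
  then show ?thesis
    by (simp add: cstieltjes_of_real D)
qed

lemma stieltjes_deriv_nonneg: "0 \<le> stieltjes_deriv M z"
  by (simp add: stieltjes_deriv_def)

lemma stieltjes_mono:
  assumes "compactly_supported_distribution M" "a \<le> b" "b < supp_inf M"
  shows "stieltjes M a \<le> stieltjes M b"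
proof (rule DERIV_nonneg_imp_nondecreasing[OF assms(2)])
  fix x assume "a \<le> x" "x \<le> b"
  then show "\<exists>y. (stieltjes M has_real_derivative y) (at x) \<and> 0 \<le> y"
    using stieltjes_has_derivative[OF assms(1), of x] stieltjes_deriv_nonneg[of M x] assms by auto
qed

text \<open>Integrate \<open>1 / u \<ge> 2 l / v - l\<^sup>2 u / v\<^sup>2\<close> with \<open>u = x - h\<close> and \<open>v = x - h\<^sub>0\<close>.\<close>

lemma stieltjes_lower_bound:
  assumes M: "compactly_supported_distribution M" and h: "h < supp_inf M" "h0 < supp_inf M"
  shows "(2 * l - l\<^sup>2) * stieltjes M h0 + l\<^sup>2 * (h - h0) * stieltjes_deriv M h0 \<le> stieltjes M h"
proof -
  interpret prob_space M by (rule compactly_supported_distributionD(1)[OF M])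
  note [measurable_cong] = compactly_supported_distributionD(2)[OF M]
  have AE: "AE x in M. supp_inf M \<le> x"
    by (rule compactly_supported_distributionD(4)[OF M])
  have int: "integrable M (\<lambda>x. (1 / (x - z)) ^ n)" if "z < supp_inf M" for z n
  proof (rule integrable_const_bound)
    show "AE x in M. norm ((1 / (x - z)) ^ n) \<le> (1 / (supp_inf M - z)) ^ n"
      using AE
    proof eventually_elim
      case (elim x)
      then show ?case
        using that unfolding norm_power by (intro power_mono) (auto simp: frac_le)
    qed
  qed measurable
  have int1: "integrable M (\<lambda>x. 1 / (x - h0))" "integrable M (\<lambda>x. 1 / (x - h))"
    using int[of h0 1] int[of h 1] h by simp_all
  have "(\<integral>x. (2 * l - l\<^sup>2) * (1 / (x - h0)) + l\<^sup>2 * (h - h0) * (1 / (x - h0))\<^sup>2 \<partial>M) \<le> stieltjes M h"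
    unfolding stieltjes_def
  proof (rule integral_mono_AE)
    show "integrable M (\<lambda>x. (2 * l - l\<^sup>2) * (1 / (x - h0)) + l\<^sup>2 * (h - h0) * (1 / (x - h0))\<^sup>2)"
      by (intro Bochner_Integration.integrable_add integrable_mult_right int1 int h)
    show "AE x in M. (2 * l - l\<^sup>2) * (1 / (x - h0)) + l\<^sup>2 * (h - h0) * (1 / (x - h0))\<^sup>2 \<le> 1 / (x - h)"
      using AE
    proof eventually_elim
      case (elim x)
      define u v where "u = x - h" and "v = x - h0"
      have uv: "u > 0" "v > 0" "h - h0 = v - u"
        using elim h by (simp_all add: u_def v_def)
      have "1 / u - ((2 * l - l\<^sup>2) * (1 / v) + l\<^sup>2 * (v - u) * (1 / v)\<^sup>2) = u * (1 / u - l / v)\<^sup>2"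
        using uv by (simp add: power2_eq_square divide_simps) (simp add: algebra_simps)
      also have "\<dots> \<ge> 0"
        using uv by simp
      finally show ?case
        unfolding uv(3) u_def[symmetric] v_def[symmetric] by simp
    qed
  qed (rule int1)
  also have "(\<integral>x. (2 * l - l\<^sup>2) * (1 / (x - h0)) + l\<^sup>2 * (h - h0) * (1 / (x - h0))\<^sup>2 \<partial>M)
      = (\<integral>x. (2 * l - l\<^sup>2) * (1 / (x - h0)) \<partial>M) + (\<integral>x. l\<^sup>2 * (h - h0) * (1 / (x - h0))\<^sup>2 \<partial>M)"
    by (intro Bochner_Integration.integral_add integrable_mult_right int1 int h)
  finally show ?thesis
    by (simp only: stieltjes_def stieltjes_deriv_def integral_mult_right_zero)
qed

text \<open>The lower bound at \<open>l = 1\<close> is the tangent inequality and gives the weak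
  form. Moving \<open>l\<close> slightly from 1, in the direction of the sign of \<open>y\<close>,
  makes it strict.\<close>

lemma semicircle_strict_max:
  assumes M: "compactly_supported_distribution M" and h: "h < supp_inf M" "h0 < supp_inf M" "h \<noteq> h0"
    and crit: "1 + - \<beta>\<^sup>2 * stieltjes_deriv M h0 = 0"
  shows "h + - \<beta>\<^sup>2 * stieltjes M h < h0 + - \<beta>\<^sup>2 * stieltjes M h0"
proof -
  define g d y where "g = stieltjes M h0" and "d = stieltjes_deriv M h0" and "y = (h - h0) * d"
  have \<beta>: "\<beta>\<^sup>2 * d = 1"
    using crit by (simp add: d_def)
  then have "d \<noteq> 0" "\<beta>\<^sup>2 > 0" by auto
  then have y: "y \<noteq> 0"
    using h by (simp add: y_def)
  text \<open>The bound at \<open>l = 1 + \<epsilon>\<close> is \<open>g + y + 2 \<epsilon> y + \<epsilon>\<^sup>2 (y - g)\<close>.\<close>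
  define \<epsilon> where "\<epsilon> = y / (1 + \<bar>y - g\<bar>)"
  have \<epsilon>: "\<epsilon> * (1 + \<bar>y - g\<bar>) = y"
    by (simp add: \<epsilon>_def add_pos_nonneg)
  have "\<epsilon> \<noteq> 0" using \<epsilon> y by auto
  have "\<epsilon> * y = \<epsilon>\<^sup>2 * (1 + \<bar>y - g\<bar>)"
    using \<epsilon> by (metis mult.assoc power2_eq_square)
  then have "2 * \<epsilon> * y + \<epsilon>\<^sup>2 * (y - g) = \<epsilon>\<^sup>2 * (2 + 2 * \<bar>y - g\<bar> + (y - g))"
    by (simp add: algebra_simps)
  also have "\<dots> > 0"
    using \<open>\<epsilon> \<noteq> 0\<close> by (intro mult_pos_pos) (auto simp: abs_if)
  finally have "g + y < g + y + (2 * \<epsilon> * y + \<epsilon>\<^sup>2 * (y - g))"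
    by simp
  also have "\<dots> = (2 * (1 + \<epsilon>) - (1 + \<epsilon>)\<^sup>2) * g + (1 + \<epsilon>)\<^sup>2 * (h - h0) * d"
    by (simp add: y_def power2_eq_square algebra_simps)
  also have "\<dots> \<le> stieltjes M h"
    unfolding g_def d_def by (rule stieltjes_lower_bound[OF M h(1,2)])
  finally have "\<beta>\<^sup>2 * (g + y) < \<beta>\<^sup>2 * stieltjes M h"
    using \<open>\<beta>\<^sup>2 > 0\<close> by (rule mult_strict_left_mono)
  moreover have "\<beta>\<^sup>2 * y = h - h0"
    using \<beta> by (simp add: y_def mult.left_commute)
  ultimately show ?thesis
    by (simp add: g_def distrib_left)
qed

text \<open>After adding 1, the lower bound is \<open>2 l s - l\<^sup>2 (s - y)\<close> plus
  \<open>(l - 1)\<^sup>2\<close>. The first part is optimised over \<open>l\<close>; the second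
  gives strictness.\<close>

lemma marchenko_pastur_strict_max:
  assumes M: "compactly_supported_distribution M" and h: "h < supp_inf M" "h0 < supp_inf M" "h \<noteq> h0"
    and "\<beta> > 0" and crit: "1 + - \<beta> / (1 + stieltjes M h0)\<^sup>2 * stieltjes_deriv M h0 = 0"
  shows "h + \<beta> / (1 + stieltjes M h) < h0 + \<beta> / (1 + stieltjes M h0)"
proof -
  define s d y where "s = 1 + stieltjes M h0" and "d = stieltjes_deriv M h0" and "y = (h - h0) * d"
  have s: "s > 1" and s': "1 + stieltjes M h > 0"
    using stieltjes_pos[OF M h(2)] stieltjes_pos[OF M h(1)] by (simp_all add: s_def)
  have \<beta>: "\<beta> * d = s\<^sup>2"
    using crit s by (simp add: d_def s_def[symmetric] field_simps)
  then have "d \<noteq> 0"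
    using s by auto
  then have y: "y \<noteq> 0"
    using h by (simp add: y_def)
  have bound: "2 * l * s - l\<^sup>2 * (s - y) \<le> 1 + stieltjes M h - (l - 1)\<^sup>2" for l
    using stieltjes_lower_bound[OF M h(1,2), of l]
    by (simp add: s_def y_def d_def power2_eq_square algebra_simps)
  \<comment> \<open>Otherwise the lower bound would be unbounded in \<open>l\<close>.\<close>
  have sy: "s - y > 0"
  proof (rule ccontr)
    assume "\<not> s - y > 0"
    then have *: "2 * l * s \<le> 1 + stieltjes M h" for l
      using bound[of l] by (smt (verit) mult_nonneg_nonpos zero_le_power2)
    show False
      using *[of "(2 + stieltjes M h) / (2 * s)"] s by simp
  qed
  \<comment> \<open>The vertex of the parabola; it differs from 1 because
    \<open>y \<noteq> 0\<close>.\<close>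
  define l where "l = s / (s - y)"
  have ls: "l * (s - y) = s"
    using sy by (simp add: l_def)
  have "l \<noteq> 1"
    using ls y by auto
  have "2 * l * s - l\<^sup>2 * (s - y) = l * s"
    using ls by (simp add: power2_eq_square algebra_simps)
  then have "l * s < 1 + stieltjes M h"
    using bound[of l] \<open>l \<noteq> 1\<close> by (smt (verit) right_minus_eq zero_less_power2)
  then have "s\<^sup>2 < (1 + stieltjes M h) * (s - y)"
    using sy by (simp add: l_def power2_eq_square pos_divide_less_eq)
  then have "\<beta> * s\<^sup>2 < \<beta> * ((1 + stieltjes M h) * (s - y))"
    using \<open>\<beta> > 0\<close> by (rule mult_strict_left_mono)
  moreover have m: "\<beta> * (s - y) = s * (\<beta> - s * (h - h0))"
  proof -
    have "\<beta> * (s - y) = \<beta> * s - (h - h0) * (\<beta> * d)"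
      by (simp add: y_def algebra_simps)
    then show ?thesis
      unfolding \<beta> by (simp add: power2_eq_square algebra_simps)
  qed
  moreover have "\<beta> * ((1 + stieltjes M h) * (s - y)) = s * ((1 + stieltjes M h) * (\<beta> - s * (h - h0)))"
    unfolding mult.left_commute[of \<beta> "1 + stieltjes M h"] m by (rule mult.left_commute)
  ultimately have "s * (\<beta> * s) < s * ((1 + stieltjes M h) * (\<beta> - s * (h - h0)))"
    by (simp only: power2_eq_square mult.left_commute[of \<beta> s])
  then have "\<beta> * s < (1 + stieltjes M h) * (\<beta> - s * (h - h0))"
    using s by simp
  then have "\<beta> / (1 + stieltjes M h) < (\<beta> - s * (h - h0)) / s"
    using s s' by (simp add: divide_less_eq pos_less_divide_eq mult_ac)
  also have "\<dots> = \<beta> / s - (h - h0)"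
    using s by (simp add: field_simps)
  finally show ?thesis
    by (simp add: s_def)
qed

section \<open>An identity theorem along a ray\<close>

text \<open>\<open>A\<close> may be disconnected, so the identity theorem is applied on the
  component containing the ray.\<close>

lemma holomorphic_eq_on_ray:
  fixes f g :: "complex \<Rightarrow> complex"
  assumes "open A" "f holomorphic_on A" "g holomorphic_on A"
    and A: "\<And>x :: real. x < t \<Longrightarrow> of_real x \<in> A"
    and eq: "\<And>x :: real. x < a \<Longrightarrow> f (of_real x) = g (of_real x)" and "x < t"
  shows "f (of_real x) = g (of_real x)"
proof -
  define b where "b = min a t - 1"
  have b: "b < t" "b < min a t"
    by (auto simp: b_def min_def)
  define S where "S = connected_component_set A (of_real b)"
  have ray: "of_real y \<in> S" if "y < t" for y
  proof -
    have "connected (complex_of_real ` {..<t})"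
      by (intro connected_continuous_image continuous_intros) auto
    then have "complex_of_real ` {..<t} \<subseteq> S"
      unfolding S_def by (intro connected_component_maximal imageI) (use A b in auto)
    then show ?thesis using that by auto
  qed
  have sub: "S \<subseteq> A"
    by (simp add: S_def connected_component_subset)
  have "f (of_real x) - g (of_real x) = 0"
  proof (rule analytic_continuation[where f = "\<lambda>z. f z - g z" and w = "of_real x" and S = S
        and U = "of_real ` {..<min a t}" and \<xi> = "of_real b"])
    show "(\<lambda>z. f z - g z) holomorphic_on S"
      using sub assms(2,3) by (intro holomorphic_on_diff) (auto intro: holomorphic_on_subset)
    show "open S" "connected S"
      using assms(1) by (simp_all add: S_def open_connected_component)
    show "of_real ` {..<min a t} \<subseteq> S" "complex_of_real b \<in> S" "of_real x \<in> S"
      using ray \<open>x < t\<close> b by auto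
    show "complex_of_real b islimpt of_real ` {..<min a t}"
      unfolding islimpt_approachable
    proof (intro allI impI)
      fix \<epsilon> :: real assume "\<epsilon> > 0"
      then show "\<exists>w\<in>of_real ` {..<min a t}. w \<noteq> complex_of_real b \<and> dist w (of_real b) < \<epsilon>"
        by (intro bexI[of _ "of_real (b - \<epsilon> / 2)"] imageI)
          (use b in \<open>auto simp: dist_norm simp del: of_real_diff simp flip: of_real_diff\<close>)
    qed
    show "f z - g z = 0" if "z \<in> of_real ` {..<min a t}" for z
      using that eq by auto
  qed
  then show ?thesis by simp
qed

section \<open>The edge of the free convolution\<close>

lemma argsup_belowI:
  assumes "is_argsup_below e f h" "\<And>x. is_argsup_below e f x \<Longrightarrow> x = h"
  shows "argsup_below e f = h"
  unfolding argsup_below_def using assms by (rule the_equality)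

text \<open>\<open>\<kappa> g\<close> is the R-transform of the law \<open>\<mu>\<close> at
  \<open>- g\<close>, and \<open>K\<close> is its holomorphic extension to the right half-plane. The
  bound \<open>c\<close> forces \<open>F h\<close> to minus infinity with \<open>h\<close>.\<close>

locale free_subordination =
  fixes \<nu> \<rho> :: "real measure" and K :: "complex \<Rightarrow> complex" and \<kappa> \<kappa>' :: "real \<Rightarrow> real" and c :: real
  assumes \<nu>: "compactly_supported_distribution \<nu>" and \<rho>: "compactly_supported_distribution \<rho>"
    and K_holomorphic: "K holomorphic_on {g. 0 < Re g}"
    and K_of_real: "\<And>g. 0 < g \<Longrightarrow> K (of_real g) = of_real (\<kappa> g)"
    and \<kappa>_derivative: "\<And>g. 0 < g \<Longrightarrow> (\<kappa> has_real_derivative \<kappa>' g) (at g)"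
    and \<kappa>'_neg: "\<And>g. 0 < g \<Longrightarrow> \<kappa>' g < 0" and \<kappa>_le: "\<And>g. 0 < g \<Longrightarrow> \<kappa> g \<le> c"
    and near_bot: "eventually (\<lambda>h. stieltjes \<rho> (h + \<kappa> (stieltjes \<nu> h)) = stieltjes \<nu> h) at_bot"
    and strict_max: "\<And>h0 h. \<lbrakk>h < supp_inf \<nu>; h0 < supp_inf \<nu>; h \<noteq> h0;
        1 + \<kappa>' (stieltjes \<nu> h0) * stieltjes_deriv \<nu> h0 = 0\<rbrakk>
      \<Longrightarrow> h + \<kappa> (stieltjes \<nu> h) < h0 + \<kappa> (stieltjes \<nu> h0)"
begin

definition F :: "real \<Rightarrow> real" where "F h = h + \<kappa> (stieltjes \<nu> h)"
definition H :: "real \<Rightarrow> real" where "H z = z - \<kappa> (stieltjes \<rho> z)"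
definition Fc :: "complex \<Rightarrow> complex" where "Fc w = w + K (cstieltjes \<nu> w)"
definition Hc :: "complex \<Rightarrow> complex" where "Hc w = w - K (cstieltjes \<rho> w)"

lemma \<kappa>_antimono:
  assumes "0 < a" "a \<le> b"
  shows "\<kappa> b \<le> \<kappa> a"
proof (rule DERIV_nonpos_imp_nonincreasing[OF assms(2)])
  fix x assume "a \<le> x" "x \<le> b"
  then show "\<exists>y. (\<kappa> has_real_derivative y) (at x) \<and> y \<le> 0"
    using \<kappa>_derivative[of x] \<kappa>'_neg[of x] assms(1) by (intro exI[of _ "\<kappa>' x"]) auto
qed

lemma H_derivative:
  assumes "z < supp_inf \<rho>"
  shows "(H has_real_derivative 1 - \<kappa>' (stieltjes \<rho> z) * stieltjes_deriv \<rho> z) (at z)"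
  unfolding H_def[abs_def]
  by (intro DERIV_diff DERIV_ident DERIV_chain2[OF \<kappa>_derivative] stieltjes_pos stieltjes_has_derivative \<rho> assms)

lemma H_derivative_pos:
  assumes "z < supp_inf \<rho>"
  shows "0 < 1 - \<kappa>' (stieltjes \<rho> z) * stieltjes_deriv \<rho> z"
proof -
  have "\<kappa>' (stieltjes \<rho> z) * stieltjes_deriv \<rho> z \<le> 0"
    using \<kappa>'_neg[OF stieltjes_pos[OF \<rho> assms]] stieltjes_deriv_nonneg[of \<rho> z]
    by (intro mult_nonpos_nonneg) auto
  then show ?thesis by simp
qed

lemma H_strict_mono:
  assumes "a < b" "b < supp_inf \<rho>"
  shows "H a < H b"
proof (rule DERIV_pos_imp_increasing[OF assms(1)])
  fix x assume "a \<le> x" "x \<le> b"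
  then show "\<exists>y. (H has_real_derivative y) (at x) \<and> 0 < y"
    using H_derivative[of x] H_derivative_pos[of x] assms by auto
qed

lemma H_continuous: "b < supp_inf \<rho> \<Longrightarrow> continuous_on {a..b} H"
  by (intro continuous_at_imp_continuous_on ballI DERIV_isCont[OF H_derivative]) auto

lemma F_derivative:
  assumes "h < supp_inf \<nu>"
  shows "(F has_real_derivative 1 + \<kappa>' (stieltjes \<nu> h) * stieltjes_deriv \<nu> h) (at h)"
  unfolding F_def[abs_def]
  by (intro DERIV_add DERIV_ident DERIV_chain2[OF \<kappa>_derivative] stieltjes_pos stieltjes_has_derivative \<nu> assms)

lemma F_continuous: "b < supp_inf \<nu> \<Longrightarrow> continuous_on {a..b} F"
  by (intro continuous_at_imp_continuous_on ballI DERIV_isCont[OF F_derivative]) auto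

lemma F_le: "h < supp_inf \<nu> \<Longrightarrow> F h \<le> h + c"
  using \<kappa>_le[OF stieltjes_pos[OF \<nu>]] by (simp add: F_def)

lemma Fc_holomorphic: "Fc holomorphic_on {w. Re w < supp_inf \<nu>}"
proof -
  have "(K \<circ> cstieltjes \<nu>) holomorphic_on {w. Re w < supp_inf \<nu>}"
    by (rule holomorphic_on_compose_gen[OF cstieltjes_holomorphic[OF \<nu>] K_holomorphic])
      (use cstieltjes_Re_pos[OF \<nu>] in auto)
  then show ?thesis
    unfolding Fc_def[abs_def] by (intro holomorphic_intros) (simp add: o_def)
qed

lemma Hc_holomorphic: "Hc holomorphic_on {w. Re w < supp_inf \<rho>}"
proof -
  have "(K \<circ> cstieltjes \<rho>) holomorphic_on {w. Re w < supp_inf \<rho>}"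
    by (rule holomorphic_on_compose_gen[OF cstieltjes_holomorphic[OF \<rho>] K_holomorphic])
      (use cstieltjes_Re_pos[OF \<rho>] in auto)
  then show ?thesis
    unfolding Hc_def[abs_def] by (intro holomorphic_intros) (simp add: o_def)
qed

lemma Fc_of_real: "h < supp_inf \<nu> \<Longrightarrow> Fc (of_real h) = of_real (F h)"
  by (simp add: Fc_def F_def cstieltjes_of_real K_of_real stieltjes_pos[OF \<nu>])

lemma Hc_of_real: "z < supp_inf \<rho> \<Longrightarrow> Hc (of_real z) = of_real (H z)"
  by (simp add: Hc_def H_def cstieltjes_of_real K_of_real stieltjes_pos[OF \<rho>])

section \<open>Subordination up to the edge of the convolution\<close>

text \<open>\<open>near_bot\<close> is a statement about \<open>h\<close>. Every sufficiently small
  \<open>z\<close> has the form \<open>F h\<close> with such an \<open>h\<close>, and then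
  \<open>H z = h\<close>.\<close>

lemma subordination_near_bot:
  "\<exists>z0. \<forall>z<z0. H z < supp_inf \<nu> \<and> stieltjes \<nu> (H z) = stieltjes \<rho> z"
proof -
  obtain a where a: "\<And>h. h \<le> a \<Longrightarrow> stieltjes \<rho> (F h) = stieltjes \<nu> h"
    using near_bot unfolding eventually_at_bot_linorder F_def by blast
  define b where "b = min a (supp_inf \<nu> - 1)"
  have b: "b \<le> a" "b < supp_inf \<nu>"
    by (auto simp: b_def min_def)
  show ?thesis
  proof (intro exI[of _ "F b"] allI impI)
    fix z assume z: "z < F b"
    \<comment> \<open>Chosen so that \<open>F b' \<le> b' + c \<le> z\<close>, the left bound for
      the intermediate value theorem.\<close>
    define b' where "b' = min b (z - c)"
    have "b' < supp_inf \<nu>" "b' \<le> z - c"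
      using b by (auto simp: b'_def)
    then have "F b' \<le> z"
      using F_le[of b'] by linarith
    then have "\<exists>h. b' \<le> h \<and> h \<le> b \<and> F h = z"
      using z by (intro IVT' F_continuous b) (auto simp: b'_def)
    then obtain h where h: "h \<le> b" "F h = z" by blast
    then have "stieltjes \<rho> z = stieltjes \<nu> h"
      using a[of h] b by simp
    then have "H z = h"
      using h(2) by (simp add: H_def F_def)
    then show "H z < supp_inf \<nu> \<and> stieltjes \<nu> (H z) = stieltjes \<rho> z"
      using h b \<open>stieltjes \<rho> z = stieltjes \<nu> h\<close> by simp
  qed
qed

text \<open>The identity near minus infinity continues analytically as long as \<open>H\<close>
  stays below the edge of \<open>\<nu>\<close>.\<close>

lemma subordination_below:
  assumes "t \<le> supp_inf \<rho>" and below: "\<And>x. x < t \<Longrightarrow> H x < supp_inf \<nu>" and "z < t"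
  shows "stieltjes \<nu> (H z) = stieltjes \<rho> z"
proof -
  obtain z0 where z0: "\<And>z. z < z0 \<Longrightarrow> stieltjes \<nu> (H z) = stieltjes \<rho> z"
    using subordination_near_bot by blast
  define U where "U = {w. Re w < supp_inf \<rho>}"
  define A where "A = U \<inter> Hc -` {w. Re w < supp_inf \<nu>}"
  have "open A"
    unfolding A_def U_def
    by (intro continuous_open_preimage holomorphic_on_imp_continuous_on Hc_holomorphic open_Re_less)
  moreover have "(cstieltjes \<nu> \<circ> Hc) holomorphic_on A"
    by (rule holomorphic_on_compose_gen[OF holomorphic_on_subset[OF Hc_holomorphic] cstieltjes_holomorphic[OF \<nu>]])
      (auto simp: A_def U_def)
  moreover have "cstieltjes \<rho> holomorphic_on A"
    by (rule holomorphic_on_subset[OF cstieltjes_holomorphic[OF \<rho>]]) (auto simp: A_def U_def)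
  ultimately have "(cstieltjes \<nu> \<circ> Hc) (of_real z) = cstieltjes \<rho> (of_real z)"
  proof (rule holomorphic_eq_on_ray[where a = "min t z0" and t = t])
    show "of_real x \<in> A" if "x < t" for x
      using that below[of x] assms(1) by (simp add: A_def U_def Hc_of_real)
    show "(cstieltjes \<nu> \<circ> Hc) (of_real x) = cstieltjes \<rho> (of_real x)" if "x < min t z0" for x
      using that z0[of x] assms(1) by (simp add: Hc_of_real cstieltjes_of_real)
  qed fact
  then show ?thesis
    using assms by (simp add: Hc_of_real cstieltjes_of_real)
qed

text \<open>If \<open>H\<close> reached the edge of the support of \<open>\<nu>\<close> before that of \<open>\<rho>\<close>, the inverse of \<open>H\<close> would
  continue the transform of \<open>\<nu>\<close> past its edge.\<close>

lemma H_less: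
  assumes "z < supp_inf \<rho>"
  shows "H z < supp_inf \<nu>"
proof (rule ccontr)
  assume "\<not> H z < supp_inf \<nu>"
  obtain z0 where z0: "\<And>z. z < z0 \<Longrightarrow> H z < supp_inf \<nu>"
    using subordination_near_bot by blast
  define a where "a = min z z0 - 1"
  have a: "a < z" "H a < supp_inf \<nu>"
    by (auto simp: a_def intro!: z0)
  have "\<exists>t. a \<le> t \<and> t \<le> z \<and> H t = supp_inf \<nu>"
    using a \<open>\<not> H z < supp_inf \<nu>\<close> by (intro IVT' H_continuous assms) auto
  then obtain t where t: "a \<le> t" "t \<le> z" "H t = supp_inf \<nu>" by blast
  have t_less: "t < supp_inf \<rho>"
    using t assms by simp
  have below: "H x < supp_inf \<nu>" if "x < t" for x
    using H_strict_mono[OF that t_less] t(3) by simp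
  have "deriv Hc (of_real t) = of_real (1 - \<kappa>' (stieltjes \<rho> t) * stieltjes_deriv \<rho> t)"
    using t_less
    by (intro deriv_eq_of_real[OF Hc_holomorphic open_Re_less _ H_derivative, of _ "t - 1" "supp_inf \<rho>"])
      (auto simp: Hc_of_real)
  then have deriv: "deriv Hc (of_real t) \<noteq> 0"
    using H_derivative_pos[OF t_less] by (simp only: of_real_eq_0_iff)
  show False
  proof (rule no_continuation_via_chart[OF \<nu> open_Re_less _ Hc_holomorphic deriv cstieltjes_holomorphic[OF \<rho>],
        where s = "t - 1" and \<phi> = H])
    show "cstieltjes \<rho> (of_real x) = of_real (stieltjes \<nu> (H x))" if "x < t" for x
      using subordination_below[OF less_imp_le[OF t_less] below that] by (simp add: cstieltjes_of_real)
  qed (use t t_less below in \<open>auto simp: Hc_of_real\<close>)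
qed

lemma stieltjes_H: "z < supp_inf \<rho> \<Longrightarrow> stieltjes \<nu> (H z) = stieltjes \<rho> z"
  by (rule subordination_below[OF order_refl H_less])

lemma F_H: "z < supp_inf \<rho> \<Longrightarrow> F (H z) = z"
  by (simp add: F_def stieltjes_H) (simp add: H_def)

section \<open>The inverse bijections \<open>F\<close> and \<open>H\<close> up to the edge\<close>

text \<open>\<open>H\<close> increases, so this is its left limit at the edge of
  \<open>\<rho>\<close>; it is finite because \<open>H\<close> stays below the edge of
  \<open>\<nu>\<close>.\<close>

definition h_edge :: real where "h_edge = Sup (H ` {..<supp_inf \<rho>})"

lemma h_edge_le: "h_edge \<le> supp_inf \<nu>"
  unfolding h_edge_def by (intro cSUP_least) (auto intro: less_imp_le H_less)

lemma H_less_h_edge: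
  assumes "z < supp_inf \<rho>"
  shows "H z < h_edge"
proof -
  obtain y where y: "z < y" "y < supp_inf \<rho>"
    using dense[OF assms] by blast
  have "H y \<le> h_edge"
    unfolding h_edge_def using y
    by (intro cSUP_upper) (auto intro!: bdd_aboveI[of _ "supp_inf \<nu>"] less_imp_le H_less)
  then show ?thesis
    using H_strict_mono[OF y] by simp
qed

lemma less_h_edgeE:
  assumes "h < h_edge"
  obtains z where "z < supp_inf \<rho>" "H z = h"
proof -
  have "\<exists>y\<in>{..<supp_inf \<rho>}. h < H y"
    using assms unfolding h_edge_def
    by (subst (asm) less_cSUP_iff) (auto intro!: bdd_aboveI[of _ "supp_inf \<nu>"] less_imp_le H_less)
  then obtain y where y: "y < supp_inf \<rho>" "h < H y" by auto
  \<comment> \<open>For \<open>a \<le> y\<close> the monotonicity of the transform and of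
    \<open>\<kappa>\<close> gives \<open>H a \<le> a - \<kappa> (stieltjes \<rho> y)\<close>, which
    is at most \<open>h\<close> by this choice.\<close>
  define a where "a = min y (h + \<kappa> (stieltjes \<rho> y))"
  have "H a \<le> a - \<kappa> (stieltjes \<rho> y)"
    using \<kappa>_antimono[OF stieltjes_pos[OF \<rho>] stieltjes_mono[OF \<rho>], of a y] y
    by (auto simp: H_def a_def)
  then have "H a \<le> h"
    by (simp add: a_def)
  then have "\<exists>z. a \<le> z \<and> z \<le> y \<and> H z = h"
    using y by (intro IVT' H_continuous) (auto simp: a_def)
  then obtain z where "z \<le> y" "H z = h"
    by blast
  then show ?thesis
    using y that[of z] by simp
qed

lemma F_less:
  assumes "h < h_edge"
  shows "F h < supp_inf \<rho>"
proof -
  obtain z where "z < supp_inf \<rho>" "H z = h"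
    using assms by (rule less_h_edgeE)
  then show ?thesis
    using F_H[of z] by auto
qed

lemma F_strict_mono:
  assumes "a < b" "b < h_edge"
  shows "F a < F b"
proof -
  obtain x where x: "x < supp_inf \<rho>" "H x = a"
    using order.strict_trans[OF assms] by (rule less_h_edgeE)
  obtain y where y: "y < supp_inf \<rho>" "H y = b"
    using assms(2) by (rule less_h_edgeE)
  have "x < y"
    using H_strict_mono[of y x] x y assms(1) by (cases x y rule: linorder_cases) auto
  then show ?thesis
    using F_H x y by auto
qed

lemma stieltjes_F:
  assumes "h < h_edge"
  shows "stieltjes \<rho> (F h) = stieltjes \<nu> h"
proof -
  obtain z where "z < supp_inf \<rho>" "H z = h"
    using assms by (rule less_h_edgeE)
  then show ?thesis
    using F_H[of z] stieltjes_H[of z] by auto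
qed

lemma F_tendsto: "(F \<longlongrightarrow> supp_inf \<rho>) (at_left h_edge)"
proof (rule order_tendstoI)
  fix a assume "a < supp_inf \<rho>"
  then have "\<forall>h\<in>{H a<..<h_edge}. a < F h"
    using F_strict_mono[of "H a"] F_H[of a] by auto
  then show "\<forall>\<^sub>F h in at_left h_edge. a < F h"
    using eventually_at_left_real[OF H_less_h_edge[OF \<open>a < supp_inf \<rho>\<close>]] by (auto elim: eventually_mono)
next
  fix a assume "supp_inf \<rho> < a"
  have "\<forall>\<^sub>F h in at_left h_edge. h < h_edge"
    by (simp add: eventually_at_filter)
  then show "\<forall>\<^sub>F h in at_left h_edge. F h < a"
    by eventually_elim (use F_less \<open>supp_inf \<rho> < a\<close> in force)
qed

lemma H_at_left: "filterlim H (at_left h_edge) (at_left (supp_inf \<rho>))"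
proof -
  have less: "\<forall>\<^sub>F z in at_left (supp_inf \<rho>). z < supp_inf \<rho>"
    by (simp add: eventually_at_filter)
  have "(H \<longlongrightarrow> h_edge) (at_left (supp_inf \<rho>))"
  proof (rule order_tendstoI)
    fix a assume "a < h_edge"
    then obtain y where y: "y < supp_inf \<rho>" "H y = a"
      by (rule less_h_edgeE)
    then have "\<forall>z\<in>{y<..<supp_inf \<rho>}. a < H z"
      using H_strict_mono[of y] by auto
    then show "\<forall>\<^sub>F z in at_left (supp_inf \<rho>). a < H z"
      using eventually_at_left_real[OF y(1)] by (auto elim: eventually_mono)
  next
    fix a assume "h_edge < a"
    show "\<forall>\<^sub>F z in at_left (supp_inf \<rho>). H z < a"
      using less by eventually_elim (use H_less_h_edge \<open>h_edge < a\<close> in force)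
  qed
  moreover have "\<forall>\<^sub>F z in at_left (supp_inf \<rho>). H z \<in> {..<h_edge} \<and> H z \<noteq> h_edge"
    using less by eventually_elim (use H_less_h_edge in force)
  ultimately show ?thesis
    by (simp add: filterlim_at)
qed

text \<open>The transform of \<open>\<rho>\<close> at \<open>z\<close> is that of
  \<open>\<nu>\<close> at \<open>H z\<close>, and \<open>H z\<close> tends to \<open>h_edge\<close>
  from the left.\<close>

lemma stieltjes_edge_eq:
  assumes "((\<lambda>h. ereal (stieltjes \<nu> h)) \<longlongrightarrow> L) (at_left h_edge)"
  shows "stieltjes_edge \<rho> = L"
proof -
  have "((\<lambda>z. ereal (stieltjes \<nu> (H z))) \<longlongrightarrow> L) (at_left (supp_inf \<rho>))"
    using filterlim_compose[OF assms H_at_left] .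
  moreover have "\<forall>\<^sub>F z in at_left (supp_inf \<rho>). ereal (stieltjes \<nu> (H z)) = ereal (stieltjes \<rho> z)"
    by (simp add: eventually_at_filter stieltjes_H)
  ultimately have "((\<lambda>z. ereal (stieltjes \<rho> z)) \<longlongrightarrow> L) (at_left (supp_inf \<rho>))"
    by (rule Lim_transform_eventually)
  then show ?thesis
    unfolding stieltjes_edge_def by (intro tendsto_Lim) auto
qed

section \<open>Attained and approached suprema\<close>

lemma interior_edge:
  assumes "h_edge < supp_inf \<nu>"
  shows "F h_edge = supp_inf \<rho>" "\<And>h. h < supp_inf \<nu> \<Longrightarrow> h \<noteq> h_edge \<Longrightarrow> F h < F h_edge"
proof -
  have "(F \<longlongrightarrow> F h_edge) (at_left h_edge)"
    using DERIV_isCont[OF F_derivative[OF assms]] by (simp add: isCont_def filterlim_at_split)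
  then show F_edge: "F h_edge = supp_inf \<rho>"
    using F_tendsto tendsto_unique[of "at_left h_edge"] by auto
  define d where "d = 1 + \<kappa>' (stieltjes \<nu> h_edge) * stieltjes_deriv \<nu> h_edge"
  have deriv: "deriv Fc (of_real h_edge) = of_real d"
    unfolding d_def using assms
    by (intro deriv_eq_of_real[OF Fc_holomorphic open_Re_less _ F_derivative, of _ "h_edge - 1" "supp_inf \<nu>"])
      (auto simp: Fc_of_real)
  \<comment> \<open>The roles in \<open>H_less\<close> are exchanged: \<open>Fc\<close> is the
    chart, and the transform of \<open>\<nu>\<close> would continue that of
    \<open>\<rho>\<close>.\<close>
  have "d = 0"
  proof (rule ccontr)
    assume "d \<noteq> 0"
    then have deriv: "deriv Fc (of_real h_edge) \<noteq> 0"
      by (simp add: deriv)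
    show False
    proof (rule no_continuation_via_chart[OF \<rho> open_Re_less _ Fc_holomorphic deriv cstieltjes_holomorphic[OF \<nu>],
          where s = "h_edge - 1" and \<phi> = F])
      show "cstieltjes \<nu> (of_real x) = of_real (stieltjes \<rho> (F x))" if "x < h_edge" for x
        using stieltjes_F[OF that] by (simp add: cstieltjes_of_real)
    qed (use assms F_edge F_less in \<open>auto simp: Fc_of_real\<close>)
  qed
  then show "F h < F h_edge" if "h < supp_inf \<nu>" "h \<noteq> h_edge" for h
    using strict_max[OF that(1) assms that(2)] by (simp add: F_def d_def)
qed

lemma edge_interior_case:
  assumes "h_edge < supp_inf \<nu>"
  shows "ereal (supp_inf \<rho>) = (SUP h\<in>{..<supp_inf \<nu>}. ereal (F h)) \<and>
    stieltjes_edge \<rho> = stieltjes_ext \<nu> (argsup_below (supp_inf \<nu>) F)"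
proof
  note edge = interior_edge[OF assms]
  show "ereal (supp_inf \<rho>) = (SUP h\<in>{..<supp_inf \<nu>}. ereal (F h))"
  proof (rule SUP_eqI[symmetric])
    fix h assume "h \<in> {..<supp_inf \<nu>}"
    then show "ereal (F h) \<le> ereal (supp_inf \<rho>)"
      using edge(2)[of h] edge(1) by (cases "h = h_edge") auto
  next
    fix y assume "\<And>h. h \<in> {..<supp_inf \<nu>} \<Longrightarrow> ereal (F h) \<le> y"
    from this[of h_edge] show "ereal (supp_inf \<rho>) \<le> y"
      using assms edge(1) by simp
  qed
  \<comment> \<open>The maximiser is unique, and its existence rules out the second alternative of
    \<open>is_argsup_below\<close>.\<close>
  have max: "is_arg_max F (\<lambda>x. x < supp_inf \<nu>) h \<longleftrightarrow> h = h_edge" for h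
    using edge(2) assms by (auto simp: is_arg_max_def) (metis order.asym)
  then have "argsup_below (supp_inf \<nu>) F = h_edge"
    by (intro argsup_belowI) (auto simp: is_argsup_below_def)
  moreover have "stieltjes_edge \<rho> = ereal (stieltjes \<nu> h_edge)"
  proof (rule stieltjes_edge_eq)
    have "isCont (stieltjes \<nu>) h_edge"
      by (rule DERIV_isCont[OF stieltjes_has_derivative[OF \<nu> assms]])
    then show "((\<lambda>h. ereal (stieltjes \<nu> h)) \<longlongrightarrow> ereal (stieltjes \<nu> h_edge)) (at_left h_edge)"
      by (intro tendsto_ereal) (simp add: isCont_def filterlim_at_split)
  qed
  ultimately show "stieltjes_edge \<rho> = stieltjes_ext \<nu> (argsup_below (supp_inf \<nu>) F)"
    using assms by (simp add: stieltjes_ext_def)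
qed

lemma edge_boundary_case:
  assumes e: "h_edge = supp_inf \<nu>"
  shows "ereal (supp_inf \<rho>) = (SUP h\<in>{..<supp_inf \<nu>}. ereal (F h)) \<and>
    stieltjes_edge \<rho> = stieltjes_ext \<nu> (argsup_below (supp_inf \<nu>) F)"
proof
  show sup: "ereal (supp_inf \<rho>) = (SUP h\<in>{..<supp_inf \<nu>}. ereal (F h))"
  proof (rule SUP_eqI[symmetric])
    fix h assume "h \<in> {..<supp_inf \<nu>}"
    then show "ereal (F h) \<le> ereal (supp_inf \<rho>)"
      using F_less[of h] e by simp
  next
    fix y assume y: "\<And>h. h \<in> {..<supp_inf \<nu>} \<Longrightarrow> ereal (F h) \<le> y"
    \<comment> \<open>Every real \<open>r\<close> below the edge of \<open>\<rho>\<close> is the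
      value \<open>F (H r)\<close>.\<close>
    show "ereal (supp_inf \<rho>) \<le> y"
    proof (rule dense_le)
      fix x assume "x < ereal (supp_inf \<rho>)"
      show "x \<le> y"
      proof (cases x)
        case (real r)
        then show ?thesis
          using \<open>x < ereal (supp_inf \<rho>)\<close> y[of "H r"] H_less[of r] F_H[of r] by simp
      qed (use \<open>x < ereal (supp_inf \<rho>)\<close> in auto)
    qed
  qed
  \<comment> \<open>\<open>F\<close> increases strictly up to the edge, so the second alternative of
    \<open>is_argsup_below\<close> applies.\<close>
  have no_max: "\<not> is_arg_max F (\<lambda>x. x < supp_inf \<nu>) h" for h
  proof
    assume *: "is_arg_max F (\<lambda>x. x < supp_inf \<nu>) h"
    then obtain y where "h < y" "y < h_edge"
      using dense[of h h_edge] e by (auto simp: is_arg_max_def)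
    then show False
      using * F_strict_mono[of h y] e by (auto simp: is_arg_max_def)
  qed
  have "((\<lambda>x. ereal (F x)) \<longlongrightarrow> (SUP h\<in>{..<supp_inf \<nu>}. ereal (F h))) (at_left (supp_inf \<nu>))"
    using tendsto_ereal[OF F_tendsto] by (simp add: sup[symmetric] e)
  then have "argsup_below (supp_inf \<nu>) F = supp_inf \<nu>"
    using no_max by (intro argsup_belowI) (auto simp: is_argsup_below_def)
  moreover have "stieltjes_edge \<rho> = stieltjes_edge \<nu>"
  proof -
    \<comment> \<open>\<open>stieltjes_edge\<close> is a \<open>Lim\<close>, so the limit has to be
      shown to exist; by monotonicity it is the supremum, possibly infinite.\<close>
    define L where "L = (SUP h\<in>{..<supp_inf \<nu>}. ereal (stieltjes \<nu> h))"
    have lim: "((\<lambda>h. ereal (stieltjes \<nu> h)) \<longlongrightarrow> L) (at_left (supp_inf \<nu>))"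
    proof (rule order_tendstoI)
      fix a assume "a < L"
      then obtain x where x: "x < supp_inf \<nu>" "a < ereal (stieltjes \<nu> x)"
        unfolding L_def less_SUP_iff by auto
      have "\<forall>h\<in>{x<..<supp_inf \<nu>}. a < ereal (stieltjes \<nu> h)"
        using x(2) stieltjes_mono[OF \<nu>, of x] by (auto intro: less_le_trans)
      then show "\<forall>\<^sub>F h in at_left (supp_inf \<nu>). a < ereal (stieltjes \<nu> h)"
        using eventually_at_left_real[OF x(1)] by (auto elim: eventually_mono)
    next
      fix a assume "L < a"
      have "\<forall>\<^sub>F h in at_left (supp_inf \<nu>). h < supp_inf \<nu>"
        by (simp add: eventually_at_filter)
      then show "\<forall>\<^sub>F h in at_left (supp_inf \<nu>). ereal (stieltjes \<nu> h) < a"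
      proof eventually_elim
        case (elim h)
        then have "ereal (stieltjes \<nu> h) \<le> L"
          unfolding L_def by (intro SUP_upper) simp
        then show ?case
          using \<open>L < a\<close> by (rule order.strict_trans1)
      qed
    qed
    have "stieltjes_edge \<nu> = L"
      unfolding stieltjes_edge_def by (rule tendsto_Lim[OF _ lim]) simp
    then show ?thesis
      using stieltjes_edge_eq lim e by simp
  qed
  ultimately show "stieltjes_edge \<rho> = stieltjes_ext \<nu> (argsup_below (supp_inf \<nu>) F)"
    by (simp add: stieltjes_ext_def)
qed

theorem edge_of_free_convolution:
  "ereal (supp_inf \<rho>) = (SUP h\<in>{..<supp_inf \<nu>}. ereal (F h)) \<and>
    stieltjes_edge \<rho> = stieltjes_ext \<nu> (argsup_below (supp_inf \<nu>) F)"
  using h_edge_le edge_interior_case edge_boundary_case by (cases "h_edge < supp_inf \<nu>") auto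

end

theorem mainTheorem4:
  fixes \<beta> :: real and \<mu> \<nu> \<rho> :: "real measure" and F :: "real \<Rightarrow> real"
  assumes "\<beta> > 0"
    and "compactly_supported_distribution \<nu>"
    and "(\<mu> = semicircle_law \<beta> \<and> F = (\<lambda>h. h - \<beta>\<^sup>2 * stieltjes \<nu> h)) \<or>
         (\<mu> = marchenko_pastur_law \<beta> \<and> F = (\<lambda>h. h + \<beta> / (1 + stieltjes \<nu> h)))"
    and "is_free_convolution \<mu> \<nu> \<rho>"
  shows "ereal (supp_inf \<rho>) = (SUP h\<in>{..<supp_inf \<nu>}. ereal (F h)) \<and>
         stieltjes_edge \<rho> = stieltjes_ext \<nu> (argsup_below (supp_inf \<nu>) F)"
proof -
  have \<rho>: "compactly_supported_distribution \<rho>"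
    using assms(4) by (simp add: is_free_convolution_def)
  note \<nu> = assms(2)
  from assms(3) show ?thesis
  proof
    assume *: "\<mu> = semicircle_law \<beta> \<and> F = (\<lambda>h. h - \<beta>\<^sup>2 * stieltjes \<nu> h)"
    \<comment> \<open>The R-transform \<open>\<beta>\<^sup>2 g\<close> at \<open>- g\<close>,
      bounded above by 0 for positive \<open>g\<close>.\<close>
    interpret S: free_subordination \<nu> \<rho> "\<lambda>g. - of_real (\<beta>\<^sup>2) * g" "\<lambda>g. - \<beta>\<^sup>2 * g" "\<lambda>_. - \<beta>\<^sup>2" 0
    proof
      show "eventually (\<lambda>h. stieltjes \<rho> (h + - \<beta>\<^sup>2 * stieltjes \<nu> h) = stieltjes \<nu> h) at_bot"
        using stieltjes_semicircle_convolution[OF assms(1) \<nu>] assms(4) * by simp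
      show "((\<lambda>g. - \<beta>\<^sup>2 * g) has_real_derivative - \<beta>\<^sup>2) (at g)" for g
        by (auto intro!: derivative_eq_intros)
    qed (use assms(1) in \<open>auto intro!: holomorphic_intros \<nu> \<rho> semicircle_strict_max[OF \<nu>, simplified]\<close>)
    have "S.F = F"
      unfolding S.F_def[abs_def] using * by simp
    with S.edge_of_free_convolution show ?thesis
      by (simp only:)
  next
    assume *: "\<mu> = marchenko_pastur_law \<beta> \<and> F = (\<lambda>h. h + \<beta> / (1 + stieltjes \<nu> h))"
    \<comment> \<open>The R-transform \<open>\<beta> / (1 - g)\<close> at \<open>- g\<close>,
      bounded by \<open>\<beta>\<close> for positive \<open>g\<close>; its pole \<open>- 1\<close>
      lies outside the right half-plane.\<close>
    interpret S: free_subordination \<nu> \<rho> "\<lambda>g. of_real \<beta> / (1 + g)" "\<lambda>g. \<beta> / (1 + g)"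
      "\<lambda>g. - \<beta> / (1 + g)\<^sup>2" \<beta>
    proof
      show "(\<lambda>g. complex_of_real \<beta> / (1 + g)) holomorphic_on {g. 0 < Re g}"
        by (intro holomorphic_intros) (auto simp: complex_eq_iff)
      show "eventually (\<lambda>h. stieltjes \<rho> (h + \<beta> / (1 + stieltjes \<nu> h)) = stieltjes \<nu> h) at_bot"
        using stieltjes_marchenko_pastur_convolution[OF assms(1) \<nu>] assms(4) * by simp
      fix g :: real assume "0 < g"
      then show "((\<lambda>g. \<beta> / (1 + g)) has_real_derivative - \<beta> / (1 + g)\<^sup>2) (at g)"
        by (auto intro!: derivative_eq_intros simp: power2_eq_square)
      show "- \<beta> / (1 + g)\<^sup>2 < 0" "\<beta> / (1 + g) \<le> \<beta>"
        using \<open>0 < g\<close> assms(1) by (simp_all add: field_simps)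
    next
      fix h0 h :: real
      assume "h < supp_inf \<nu>" "h0 < supp_inf \<nu>" "h \<noteq> h0"
        "1 + - \<beta> / (1 + stieltjes \<nu> h0)\<^sup>2 * stieltjes_deriv \<nu> h0 = 0"
      then show "h + \<beta> / (1 + stieltjes \<nu> h) < h0 + \<beta> / (1 + stieltjes \<nu> h0)"
        by (intro marchenko_pastur_strict_max[OF \<nu> _ _ _ assms(1)])
    qed (use \<nu> \<rho> in auto)
    have "S.F = F"
      unfolding S.F_def[abs_def] using * by simp
    with S.edge_of_free_convolution show ?thesis
      by (simp only:)
  qed
qed

end
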